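(* Let $G$ be a connected simple graph with at least two vertices. (a) If $G$ has no cut-vertex, then $\mathsf{els}_0(G)<0$, $\mathsf{els}_1(G)=0$, and $\mathsf{els}_k(G)>0$ for all integers $k\ge 2$. (b) Otherwise, for every integer $k\ge 0$, $\mathsf{els}_k(G)\ne 0$ if and only if $k\ge \ell$, where $\ell\ge 2$ is the number of leaves in the block-cutpoint tree of $G$, that is, the number of 2-connected components (blocks) of $G$ that contain exactly one cut-vertex of $G$.
   Context: Graphs are finite and undirected; $V(G)$ and $E(G)$ denote the vertex and edge sets. A vertex $x$ of a graph $G$ is a cut-vertex if $G-x$ (delete $x$ and all incident edges) has more connected components than $G$. The 2-connected components (blocks) of $G$ are its maximal connected subgraphs having no cut-vertex of their own (a block may be a single edge $K_2$). A nucleus of $G$ is a (nonempty) connected subgraph $N\subseteq G$, given by its vertex set $V(N)$ and edge set $E(N)$, such that $V(N)$ is a vertex cover of $G$, i.e. every edge of $G$ has at least one endpoint in $V(N)$; a single vertex with no edges is allowed as a connected subgraph. $\mathcal{N}(G)$ is the set of all nuclei of $G$. For a connected graph $G$ and an integer $k\ge 0$, the $k$-th Elser number is $$\mathsf{els}_k(G)=(-1)^{|V(G)|+1}\sum_{N\in\mathcal{N}(G)}(-1)^{|E(N)|}\,|V(N)|^k.$$ *)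

theory Defs
  imports Main
begin

type_synonym 'a ugraph = "'a set \<times> 'a set set"

abbreviation gverts :: "'a ugraph \<Rightarrow> 'a set" where
  "gverts \<equiv> fst"

abbreviation gedges :: "'a ugraph \<Rightarrow> 'a set set" where
  "gedges \<equiv> snd"

definition simple_graph :: "'a ugraph \<Rightarrow> bool" where
  "simple_graph G \<longleftrightarrow>
     finite (gverts G) \<and> (\<forall>e\<in>gedges G. e \<subseteq> gverts G \<and> card e = 2)"

text \<open>Subgraphs need not be induced: a subgraph carries its own edge set.\<close>

definition subgraph_of :: "'a ugraph \<Rightarrow> 'a ugraph \<Rightarrow> bool" where
  "subgraph_of H G \<longleftrightarrow>
     simple_graph H \<and> gverts H \<subseteq> gverts G \<and> gedges H \<subseteq> gedges G"

definition reach_rel :: "'a ugraph \<Rightarrow> ('a \<times> 'a) set" where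
  "reach_rel G =
     {(u, v). u \<in> gverts G \<and> v \<in> gverts G \<and> (u, v) \<in> {(a, b). {a, b} \<in> gedges G}\<^sup>*}"

definition components_of_graph :: "'a ugraph \<Rightarrow> 'a set set" where
  "components_of_graph G = gverts G // reach_rel G"

text \<open>The empty graph does not count as connected.\<close>

definition connected_graph :: "'a ugraph \<Rightarrow> bool" where
  "connected_graph G \<longleftrightarrow>
     gverts G \<noteq> {} \<and> (\<forall>u\<in>gverts G. \<forall>v\<in>gverts G. (u, v) \<in> reach_rel G)"

definition delete_vertex :: "'a ugraph \<Rightarrow> 'a \<Rightarrow> 'a ugraph" where
  "delete_vertex G x = (gverts G - {x}, {e \<in> gedges G. x \<notin> e})"

definition cut_vertex :: "'a ugraph \<Rightarrow> 'a \<Rightarrow> bool" where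
  "cut_vertex G x \<longleftrightarrow>
     x \<in> gverts G \<and>
     card (components_of_graph (delete_vertex G x)) > card (components_of_graph G)"

definition blocks :: "'a ugraph \<Rightarrow> 'a ugraph set" where
  "blocks G =
     {B. subgraph_of B G \<and> connected_graph B \<and> (\<nexists>x. cut_vertex B x) \<and>
         (\<forall>B'. subgraph_of B' G \<and> connected_graph B' \<and> (\<nexists>x. cut_vertex B' x) \<and>
               subgraph_of B B' \<longrightarrow> B' = B)}"

text \<open>
  The block-cutpoint tree has a node \<open>Inl B\<close> for every block \<open>B\<close> and a node \<open>Inr x\<close>
  for every cut-vertex \<open>x\<close>; \<open>Inl B\<close> and \<open>Inr x\<close> are adjacent iff \<open>x\<close> lies on \<open>B\<close>.
\<close>

definition block_cutpoint_tree :: "'a ugraph \<Rightarrow> ('a ugraph + 'a) ugraph" where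
  "block_cutpoint_tree G =
     (Inl ` blocks G \<union> Inr ` {x. cut_vertex G x},
      {{Inl B, Inr x} | B x. B \<in> blocks G \<and> cut_vertex G x \<and> x \<in> gverts B})"

definition graph_leaves :: "'a ugraph \<Rightarrow> 'a set" where
  "graph_leaves G = {v \<in> gverts G. card {e \<in> gedges G. v \<in> e} = 1}"

definition nuclei :: "'a ugraph \<Rightarrow> 'a ugraph set" where
  "nuclei G =
     {N. subgraph_of N G \<and> connected_graph N \<and> (\<forall>e\<in>gedges G. e \<inter> gverts N \<noteq> {})}"

definition els :: "nat \<Rightarrow> 'a ugraph \<Rightarrow> int" where
  "els k G =
     (- 1) ^ (card (gverts G) + 1) *
     (\<Sum>N\<in>nuclei G. (- 1) ^ card (gedges N) * int (card (gverts N)) ^ k)"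

end

theory Submission
  imports Defs
begin

text \<open>
  Group the nuclei of \<open>G\<close> by their vertex set \<open>S\<close>, a vertex cover: they contribute
  \<open>\<bar>S\<bar>^k\<close> times \<open>c(S)\<close>, the sum of \<open>(-1)^\<bar>A\<bar>\<close> over the edge sets \<open>A\<close> that make \<open>S\<close> connected.
  Since \<open>\<bar>S\<bar>^k\<close> counts the lists of length \<open>k\<close> over \<open>S\<close>, exchanging the two sums gives
  \<open>els k G = (\<Sum>xs. F (set xs))\<close> over the lists \<open>xs\<close> of \<open>k\<close> vertices, where \<open>F U\<close> is the signed
  sum of the \<open>c(S)\<close> over the vertex covers \<open>S \<supseteq> U\<close> (lemma \<open>els_eq_sum_lists\<close>). The constant
  \<open>nucleus_sum\<close> is this \<open>F\<close>, for the subgraph induced on an arbitrary vertex set \<open>W\<close>.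

  The sign of \<open>F\<close> comes from two facts. If \<open>W\<close> is connected, then \<open>F {q} W\<close> is \<open>1\<close> or \<open>0\<close> according
  to whether \<open>q\<close> is the only vertex of \<open>W\<close>: sorting all edge sets on \<open>W\<close> by the component of \<open>q\<close>
  turns the sum into an alternating sum over a full power set (\<open>nucleus_sum_singleton\<close>). And
  asking whether a cover contains \<open>v\<close> yields the recursion
  \<open>F (U \<union> {v}) W = F U W + F (U \<union> N(v)) (W - {v})\<close> (\<open>nucleus_sum_insert\<close>), without any minus sign.
  Hence \<open>F U W \<ge> 0\<close> for connected \<open>W\<close> and nonempty \<open>U\<close>, the second term being zero when
  \<open>W - {v}\<close> is disconnected; and following the recursion shows that \<open>F U W > 0\<close> exactly
  when \<open>U\<close> meets every component of \<open>W - {x}\<close>, for every vertex \<open>x\<close> of \<open>W\<close>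
  (\<open>nucleus_sum_pos_iff_spread\<close>). Such a \<open>U\<close> is called spread.

  So for \<open>k > 0\<close> the number \<open>els k G\<close> is nonnegative, and it is positive exactly when some spread
  set has at most \<open>k\<close> elements. Without cut-vertices the spread sets are those with at
  least two elements. With cut-vertices, \<open>U\<close> is spread exactly when it meets every end component,
  that is, every component of some \<open>G - x\<close>, with \<open>x\<close> a cut-vertex, that contains no cut-vertex
  of \<open>G\<close>. End components are pairwise disjoint, so the smallest spread sets have
  as many elements as there are end components; and these are the leaf blocks with their cut-vertex
  removed (\<open>bij_betw_leaf_blocks_end_components\<close>). For \<open>k = 0\<close> only \<open>U = {}\<close> contributes,
  and the recursion with \<open>v = q\<close> gives \<open>els 0 G = - F (N(q)) (V - {q})\<close>, which is negative if no
  vertex is a cut-vertex, and zero if \<open>q\<close> is one.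

  Connectedness is expressed by cuts instead of paths, and in terms of vertex sets \<open>W\<close> with a fixed
  ambient edge set \<open>E\<close>, so that deleting vertices changes \<open>W\<close> only.
\<close>

section \<open>Connectedness through cuts\<close>

text \<open>
  A union of connected components of the graph that \<open>E\<close> induces on \<open>W\<close>.
\<close>

definition side :: "'a set set \<Rightarrow> 'a set \<Rightarrow> 'a set \<Rightarrow> bool" where
  "side E W C \<longleftrightarrow> C \<subseteq> W \<and> (\<forall>a\<in>C. \<forall>b\<in>W - C. {a, b} \<notin> E)"

definition connected_on :: "'a set set \<Rightarrow> 'a set \<Rightarrow> bool" where
  "connected_on E W \<longleftrightarrow> W \<noteq> {} \<and> (\<forall>C. side E W C \<longrightarrow> C = {} \<or> C = W)"

text \<open>
  For connected \<open>W\<close>, this says that \<open>x\<close> is a cut-vertex of the induced graph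
  (see \<open>cut_vertex_iff\<close>).
\<close>

definition separates :: "'a set set \<Rightarrow> 'a set \<Rightarrow> 'a \<Rightarrow> bool" where
  "separates E W x \<longleftrightarrow> x \<in> W \<and> W - {x} \<noteq> {} \<and> \<not> connected_on E (W - {x})"

lemma side_Diff: "side E W C \<Longrightarrow> side E W (W - C)"
  unfolding side_def by (metis Diff_iff Diff_subset insert_commute)

lemma side_no_edge: "side E W C \<Longrightarrow> a \<in> C \<Longrightarrow> b \<in> W \<Longrightarrow> b \<notin> C \<Longrightarrow> {a, b} \<notin> E"
  unfolding side_def by auto

lemma side_Int:
  assumes "side E W C" "X \<subseteq> W" "A \<subseteq> E"
  shows "side A X (C \<inter> X)"
  unfolding side_def
proof (intro conjI ballI)
  fix a b assume "a \<in> C \<inter> X" "b \<in> X - C \<inter> X"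
  then have "{a, b} \<notin> E" by (intro side_no_edge[OF assms(1)]) (use assms(2) in auto)
  then show "{a, b} \<notin> A" using assms(3) by auto
qed simp

lemma side_side: "side E W C \<Longrightarrow> side E C D \<Longrightarrow> side E W D"
  unfolding side_def by blast

lemma connected_onD: "connected_on E W \<Longrightarrow> side E W C \<Longrightarrow> C \<noteq> {} \<Longrightarrow> C = W"
  unfolding connected_on_def by auto

text \<open>
  Sides come in complementary pairs, so only the one that avoids a chosen vertex needs to be examined.
\<close>

lemma connected_onI_avoiding:
  assumes "x \<in> W" and "\<And>C. side E W C \<Longrightarrow> x \<notin> C \<Longrightarrow> C = {}"
  shows "connected_on E W"
  unfolding connected_on_def
proof (intro conjI allI impI)
  show "W \<noteq> {}" using assms(1) by auto
next
  fix C assume C: "side E W C"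
  show "C = {} \<or> C = W"
  proof (cases "x \<in> C")
    case True
    then have "W - C = {}" using assms(2)[OF side_Diff[OF C]] by auto
    then show ?thesis using C unfolding side_def by auto
  qed (use assms(2)[OF C] in auto)
qed

lemma not_connected_onD:
  assumes "\<not> connected_on E W" "W \<noteq> {}"
  shows "\<exists>C. side E W C \<and> C \<noteq> {} \<and> C \<noteq> W \<and> x \<notin> C"
proof -
  obtain C where C: "side E W C" "C \<noteq> {}" "C \<noteq> W"
    using assms unfolding connected_on_def by auto
  have CW: "C \<subseteq> W" using C(1) unfolding side_def by auto
  show ?thesis
  proof (cases "x \<in> C")
    case True
    then show ?thesis
      by (intro exI[of _ "W - C"]) (use C CW side_Diff[OF C(1)] in auto)
  qed (use C in auto)
qed

lemma connected_on_cong: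
  assumes "\<And>a b. a \<in> W \<Longrightarrow> b \<in> W \<Longrightarrow> {a, b} \<in> A \<longleftrightarrow> {a, b} \<in> A'"
  shows "connected_on A W \<longleftrightarrow> connected_on A' W"
proof -
  have "side A W C \<longleftrightarrow> side A' W C" for C
    unfolding side_def using assms by (metis DiffD1 subsetD)
  then show ?thesis unfolding connected_on_def by simp
qed

lemma connected_on_mono:
  assumes "connected_on A W" "A \<subseteq> A'"
  shows "connected_on A' W"
proof -
  have "side A W C" if "side A' W C" for C
    using side_Int[OF that subset_refl assms(2)] that by (simp add: side_def Int_absorb2)
  then show ?thesis using assms(1) unfolding connected_on_def by blast
qed

lemma connected_on_singleton: "connected_on A {x}"
  unfolding connected_on_def side_def by auto

section \<open>Signed sums over nuclei\<close>

definition edges_in :: "'a set set \<Rightarrow> 'a set \<Rightarrow> 'a set set" where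
  "edges_in E X = {e \<in> E. e \<subseteq> X}"

definition connected_sum :: "'a set set \<Rightarrow> 'a set \<Rightarrow> int" where
  "connected_sum E S = (\<Sum>A | A \<subseteq> edges_in E S \<and> connected_on A S. (- 1) ^ card A)"

text \<open>
  The sum ranges over the vertex covers \<open>S \<supseteq> U\<close> of the graph induced on \<open>W\<close>. For connected
  \<open>W\<close> and any \<open>q \<in> U\<close>, the value is the number of acyclic orientations of that graph whose only
  source is \<open>q\<close> and whose sinks all lie in \<open>U\<close>; this is the conceptual reason for its sign.
\<close>

definition nucleus_sum :: "'a set set \<Rightarrow> 'a set \<Rightarrow> 'a set \<Rightarrow> int" where
  "nucleus_sum E U W = (- 1) ^ (card W + 1) *
     (\<Sum>S | U \<subseteq> S \<and> S \<subseteq> W \<and> edges_in E (W - S) = {}. connected_sum E S)"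

definition component_of :: "'a set set \<Rightarrow> 'a set \<Rightarrow> 'a \<Rightarrow> 'a set" where
  "component_of A W q = W \<inter> \<Inter>{C. side A W C \<and> q \<in> C}"

lemma component_of:
  assumes "q \<in> W"
  shows "q \<in> component_of A W q" "side A W (component_of A W q)"
    "connected_on A (component_of A W q)"
proof -
  let ?S = "component_of A W q"
  show q: "q \<in> ?S" using assms unfolding component_of_def by auto
  show s: "side A W ?S"
    unfolding side_def
  proof (intro conjI ballI)
    show "?S \<subseteq> W" unfolding component_of_def by auto
    fix a b assume a: "a \<in> ?S" and b: "b \<in> W - ?S"
    obtain C where C: "side A W C" "q \<in> C" "b \<notin> C"
      using b unfolding component_of_def by auto
    moreover have "a \<in> C" using a C unfolding component_of_def by auto
    ultimately show "{a, b} \<notin> A" using b side_no_edge by fastforce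
  qed
  show "connected_on A ?S"
  proof (rule connected_onI_avoiding[OF q])
    fix C assume C: "side A ?S C" "q \<notin> C"
    have "side A W (?S - C)" using side_side[OF s side_Diff[OF C(1)]] .
    moreover have "q \<in> ?S - C" using q C by auto
    ultimately have "?S \<subseteq> ?S - C" unfolding component_of_def by blast
    moreover have "C \<subseteq> ?S" using C(1) unfolding side_def by auto
    ultimately show "C = {}" by auto
  qed
qed

lemma component_of_unique:
  assumes "q \<in> S" "side A W S" "connected_on A S"
  shows "component_of A W q = S"
proof -
  have SW: "S \<subseteq> W" using assms(2) unfolding side_def by auto
  have q: "q \<in> W" using assms SW by auto
  let ?C = "component_of A W q"
  have "?C \<subseteq> S" unfolding component_of_def using assms by auto
  moreover have "side A S (?C \<inter> S)" using side_Int[OF component_of(2)[OF q] SW] by auto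
  ultimately show ?thesis
    using connected_onD[OF assms(3)] component_of(1)[OF q] assms(1) by blast
qed

lemma sum_Pow_alternating:
  assumes "finite X"
  shows "(\<Sum>A\<in>Pow X. (- 1) ^ card A) = (if X = {} then 1 else 0 :: int)"
  using assms
proof (induction rule: finite_induct)
  case (insert x X)
  have "(\<Sum>A\<in>Pow (insert x X). (- 1) ^ card A) =
     (\<Sum>A\<in>Pow X. (- 1) ^ card A) + (\<Sum>A\<in>insert x ` Pow X. (- 1 :: int) ^ card A)"
    unfolding Pow_insert by (rule sum.union_disjoint) (use insert in auto)
  also have "(\<Sum>A\<in>insert x ` Pow X. (- 1 :: int) ^ card A) = (\<Sum>A\<in>Pow X. (- 1) ^ card (insert x A))"
    by (rule sum.reindex_cong[where l = "insert x"]) (use insert in \<open>auto simp: inj_on_def\<close>)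
  also have "\<dots> = (\<Sum>A\<in>Pow X. - ((- 1) ^ card A))"
  proof (rule sum.cong)
    fix A assume "A \<in> Pow X"
    then have "card (insert x A) = Suc (card A)"
      using insert by (meson PowD card_insert_disjoint finite_subset subsetD)
    then show "(- 1 :: int) ^ card (insert x A) = - ((- 1) ^ card A)" by simp
  qed simp
  finally show ?case by (simp add: sum_negf)
qed simp

lemma finite_edges_in: "finite X \<Longrightarrow> finite (edges_in E X)"
  unfolding edges_in_def by (rule finite_subset[of _ "Pow X"]) auto

text \<open>
  An edge set in which \<open>S\<close> is the component of \<open>q\<close> is a connected edge set on \<open>S\<close> together with
  an arbitrary edge set on \<open>W - S\<close>. The latter choices cancel unless \<open>W - S\<close> carries no edge.
\<close>

lemma sum_subsets_with_component:
  assumes fin: "finite W" and two: "\<forall>e\<in>E. card e = 2" and q: "q \<in> S" and S: "S \<subseteq> W"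
  shows "(\<Sum>A | A \<in> Pow (edges_in E W) \<and> component_of A W q = S. (- 1) ^ card A)
       = (if edges_in E (W - S) = {} then connected_sum E S else 0)"
proof -
  let ?I = "edges_in E S" and ?O = "edges_in E (W - S)"
  let ?P = "{A. A \<subseteq> ?I \<and> connected_on A S} \<times> Pow ?O"
  have ne: "e \<noteq> {}" if "e \<in> E" for e using two that by (metis card.empty zero_neq_numeral)
  have disj: "?I \<inter> ?O = {}" using ne unfolding edges_in_def by blast
  have sub: "?I \<union> ?O \<subseteq> edges_in E W" using S unfolding edges_in_def by auto
  have fI: "finite ?I" and fO: "finite ?O"
    using fin S finite_edges_in by (metis finite_Diff finite_subset)+
  have conn: "connected_on A S \<longleftrightarrow> connected_on (A \<inter> ?I) S" if "A \<subseteq> E" for A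
    by (rule connected_on_cong) (use that in \<open>auto simp: edges_in_def\<close>)
  have qW: "q \<in> W" using q S by auto
  have split: "A \<inter> ?I \<union> A \<inter> ?O = A" if A: "A \<subseteq> edges_in E W" "side A W S" for A
  proof -
    have "e \<in> ?I \<union> ?O" if "e \<in> A" for e
    proof -
      have e: "e \<in> E" "e \<subseteq> W" using that A unfolding edges_in_def by auto
      obtain a b where ab: "e = {a, b}" using two e(1) by (metis card_2_iff)
      have "a \<in> W" "b \<in> W" using e ab by auto
      then have "a \<in> S \<longleftrightarrow> b \<in> S"
        using side_no_edge[OF A(2), of a b] side_no_edge[OF A(2), of b a] that
        unfolding ab insert_commute[of b a] by blast
      then have "e \<subseteq> S \<or> e \<subseteq> W - S" using e ab by auto
      then show ?thesis using e(1) unfolding edges_in_def by blast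
    qed
    then show ?thesis by auto
  qed
  have sideU: "side A W S" if A: "A \<subseteq> ?I \<union> ?O" for A
    unfolding side_def
  proof (intro conjI ballI)
    fix a b assume "a \<in> S" "b \<in> W - S"
    then have "\<not> {a, b} \<subseteq> S" "\<not> {a, b} \<subseteq> W - S" by auto
    then show "{a, b} \<notin> A" using A unfolding edges_in_def by blast
  qed (rule S)
  have "(\<Sum>A | A \<in> Pow (edges_in E W) \<and> component_of A W q = S. (- 1 :: int) ^ card A)
      = (\<Sum>(A1, A2)\<in>?P. (- 1) ^ card A1 * (- 1) ^ card A2)"
  proof (rule sum.reindex_bij_witness[where i = "\<lambda>(A1, A2). A1 \<union> A2"
        and j = "\<lambda>A. (A \<inter> ?I, A \<inter> ?O)"])
    fix A assume A: "A \<in> {A. A \<in> Pow (edges_in E W) \<and> component_of A W q = S}"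
    have s: "side A W S" "connected_on A S"
      using A component_of(2,3)[OF qW, of A] by auto
    have AE: "A \<subseteq> E" using A unfolding edges_in_def by auto
    have sp: "A \<inter> ?I \<union> A \<inter> ?O = A" using split A s by auto
    then show "(case (A \<inter> ?I, A \<inter> ?O) of (A1, A2) \<Rightarrow> A1 \<union> A2) = A" by simp
    show "(A \<inter> ?I, A \<inter> ?O) \<in> ?P" using conn[OF AE] s by blast
    have "card A = card (A \<inter> ?I) + card (A \<inter> ?O)"
      by (subst sp[symmetric], rule card_Un_disjoint) (use fI fO disj in auto)
    then show "(case (A \<inter> ?I, A \<inter> ?O) of (A1, A2) \<Rightarrow> (- 1 :: int) ^ card A1 * (- 1) ^ card A2) = (- 1) ^ card A"
      by (simp add: power_add)
  next
    fix p assume "p \<in> ?P"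
    then obtain A1 A2 where p: "p = (A1, A2)" "A1 \<subseteq> ?I" "connected_on A1 S" "A2 \<subseteq> ?O" by auto
    have 1: "(A1 \<union> A2) \<inter> ?I = A1" and 2: "(A1 \<union> A2) \<inter> ?O = A2" using p disj by auto
    then show "((case p of (A1, A2) \<Rightarrow> A1 \<union> A2) \<inter> ?I, (case p of (A1, A2) \<Rightarrow> A1 \<union> A2) \<inter> ?O) = p"
      using p by simp
    have s: "side (A1 \<union> A2) W S" by (rule sideU) (use p(2,4) in auto)
    have AE: "A1 \<union> A2 \<subseteq> E" using p(2,4) unfolding edges_in_def by auto
    have c: "connected_on (A1 \<union> A2) S" using conn[OF AE] p(3) unfolding 1 by blast
    have "component_of (A1 \<union> A2) W q = S" using component_of_unique[OF q s c] .
    moreover have "A1 \<union> A2 \<subseteq> edges_in E W" using p(2,4) sub by auto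
    ultimately show "(case p of (A1, A2) \<Rightarrow> A1 \<union> A2) \<in> {A. A \<in> Pow (edges_in E W) \<and> component_of A W q = S}"
      using p by simp
  qed
  also have "\<dots> = connected_sum E S * (\<Sum>A2\<in>Pow ?O. (- 1) ^ card A2)"
    unfolding connected_sum_def by (simp add: sum_product sum.cartesian_product)
  also have "\<dots> = (if ?O = {} then connected_sum E S else 0)"
    using sum_Pow_alternating[OF fO] by simp
  finally show ?thesis .
qed

text \<open>
  By the previous lemma the sum over the covers \<open>S\<close> containing \<open>q\<close> is the sum of \<open>(-1)^\<bar>A\<bar>\<close> over all edge
  sets \<open>A\<close> on \<open>W\<close>, sorted by the component of \<open>q\<close>. It vanishes as soon as \<open>W\<close> carries an edge.
\<close>

lemma nucleus_sum_singleton: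
  assumes fin: "finite W" and two: "\<forall>e\<in>E. card e = 2" and conn: "connected_on E W" and q: "q \<in> W"
  shows "nucleus_sum E {q} W = (if W = {q} then 1 else 0)"
proof -
  let ?T = "{S. {q} \<subseteq> S \<and> S \<subseteq> W}"
  have fT: "finite ?T" by (rule finite_subset[of _ "Pow W"]) (use fin in auto)
  have fP: "finite (Pow (edges_in E W))" using finite_edges_in[OF fin] by auto
  have "(\<Sum>S | {q} \<subseteq> S \<and> S \<subseteq> W \<and> edges_in E (W - S) = {}. connected_sum E S)
      = (\<Sum>S\<in>?T. if edges_in E (W - S) = {} then connected_sum E S else 0)"
    by (subst sum.inter_filter[symmetric, OF fT]) (rule sum.cong, auto)
  also have "\<dots> = (\<Sum>S\<in>?T. \<Sum>A | A \<in> Pow (edges_in E W) \<and> component_of A W q = S. (- 1) ^ card A)"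
    by (rule sum.cong[OF refl]) (use sum_subsets_with_component[OF fin two] in auto)
  also have "\<dots> = (\<Sum>A\<in>Pow (edges_in E W). (- 1) ^ card A)"
  proof (rule sum.group[OF fP fT])
    show "(\<lambda>A. component_of A W q) ` Pow (edges_in E W) \<subseteq> ?T"
      using component_of[OF q] unfolding side_def by blast
  qed
  also have "\<dots> = (if edges_in E W = {} then 1 else 0)"
    using sum_Pow_alternating[OF finite_edges_in[OF fin]] .
  also have "edges_in E W = {} \<longleftrightarrow> W = {q}"
  proof
    assume e: "edges_in E W = {}"
    have "side E W {q}" using e q unfolding side_def edges_in_def by auto
    then show "W = {q}" using connected_onD[OF conn] by blast
  next
    assume W: "W = {q}"
    { fix e assume "e \<in> E" "e \<subseteq> {q}"
      then have "card e \<le> 1" using card_mono[of "{q}" e] by simp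
      then have False using two \<open>e \<in> E\<close> by force }
    then show "edges_in E W = {}" unfolding edges_in_def W by blast
  qed
  finally show ?thesis unfolding nucleus_sum_def by auto
qed

definition neighbours :: "'a set set \<Rightarrow> 'a set \<Rightarrow> 'a \<Rightarrow> 'a set" where
  "neighbours E W v = {u \<in> W. {u, v} \<in> E}"

text \<open>
  A vertex cover of \<open>W\<close> avoiding \<open>v\<close> is a vertex cover of \<open>W - {v}\<close> containing all neighbours of \<open>v\<close>.
  The sign in \<open>nucleus_sum\<close> depends on the size of \<open>W\<close>, which turns the difference of the two
  sums into a sum.
\<close>

lemma nucleus_sum_insert:
  assumes fin: "finite W" and two: "\<forall>e\<in>E. card e = 2" and v: "v \<in> W" "v \<notin> U"
  shows "nucleus_sum E (insert v U) W =
     nucleus_sum E U W + nucleus_sum E (U \<union> neighbours E W v) (W - {v})"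
proof -
  let ?P = "\<lambda>S. U \<subseteq> S \<and> S \<subseteq> W \<and> edges_in E (W - S) = {}"
  let ?A = "{S. ?P S \<and> v \<in> S}" and ?B = "{S. ?P S \<and> v \<notin> S}"
  have fin': "finite {S. ?P S}" by (rule finite_subset[of _ "Pow W"]) (use fin in auto)
  have u: "{S. ?P S} = ?A \<union> ?B" by auto
  have "(\<Sum>S\<in>{S. ?P S}. connected_sum E S) = (\<Sum>S\<in>?A. connected_sum E S) + (\<Sum>S\<in>?B. connected_sum E S)"
    by (subst u, rule sum.union_disjoint) (auto intro: finite_subset[OF _ fin'])
  moreover have "?A = {S. insert v U \<subseteq> S \<and> S \<subseteq> W \<and> edges_in E (W - S) = {}}" by auto
  moreover have "?B = {S. U \<union> neighbours E W v \<subseteq> S \<and> S \<subseteq> W - {v} \<and> edges_in E (W - {v} - S) = {}}"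
  proof -
    \<comment> \<open>An edge not covered by \<open>S\<close> either avoids \<open>v\<close> or joins it to a neighbour outside \<open>S\<close>.\<close>
    have eq: "edges_in E (W - S) = {} \<longleftrightarrow> neighbours E W v \<subseteq> S \<and> edges_in E (W - {v} - S) = {}"
      if S: "S \<subseteq> W" "v \<notin> S" for S
    proof (intro iffI conjI)
      assume L: "edges_in E (W - S) = {}"
      show "neighbours E W v \<subseteq> S"
      proof (rule subsetI, rule ccontr)
        fix u assume "u \<in> neighbours E W v" "u \<notin> S"
        then have "{u, v} \<in> edges_in E (W - S)"
          using v(1) S(2) unfolding neighbours_def edges_in_def by simp
        then show False using L by simp
      qed
      show "edges_in E (W - {v} - S) = {}"
        using L unfolding edges_in_def by blast
    next
      assume R: "neighbours E W v \<subseteq> S \<and> edges_in E (W - {v} - S) = {}"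
      { fix e assume e: "e \<in> E" "e \<subseteq> W - S"
        have ve: "v \<in> e" using R e unfolding edges_in_def by blast
        obtain a b where ab: "e = {a, b}" using two e by (metis card_2_iff)
        obtain u where "e = {u, v}" using ab ve by blast
        then have False using R e unfolding neighbours_def by auto }
      then show "edges_in E (W - S) = {}" unfolding edges_in_def by auto
    qed
    show ?thesis
    proof (rule Collect_cong)
      fix S
      show "(?P S \<and> v \<notin> S) = (U \<union> neighbours E W v \<subseteq> S \<and> S \<subseteq> W - {v} \<and> edges_in E (W - {v} - S) = {})"
      proof (cases "S \<subseteq> W \<and> v \<notin> S")
        case True
        then have "S \<subseteq> W - {v}" by auto
        then show ?thesis using eq[of S] True by simp
      qed auto
    qed
  qed
  moreover have "card W = Suc (card (W - {v}))"
    using fin v by (metis card_Suc_Diff1)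
  ultimately show ?thesis
    unfolding nucleus_sum_def by (simp add: algebra_simps)
qed

text \<open>
  No set containing \<open>U\<close> can be connected if \<open>U\<close> has elements in different components of \<open>W\<close>.
\<close>

lemma nucleus_sum_eq_0_if_side_splits:
  assumes C: "side E W C" and U: "U \<inter> C \<noteq> {}" "U - C \<noteq> {}"
  shows "nucleus_sum E U W = 0"
proof -
  have "connected_sum E S = 0" if S: "U \<subseteq> S" "S \<subseteq> W" for S
  proof -
    have "\<not> connected_on A S" if "A \<subseteq> edges_in E S" for A
    proof
      assume c: "connected_on A S"
      have "side A S (C \<inter> S)" using side_Int[OF C S(2)] that unfolding edges_in_def by blast
      then have "C \<inter> S = S" using connected_onD[OF c] U S by blast
      then show False using U S by blast
    qed
    then have e: "{A. A \<subseteq> edges_in E S \<and> connected_on A S} = {}" by blast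
    show ?thesis unfolding connected_sum_def e by simp
  qed
  then show ?thesis unfolding nucleus_sum_def by simp
qed


section \<open>Sign of the nucleus sums\<close>

text \<open>
  Since sides are unions of components, the condition is that \<open>U\<close> meets each component of
  \<open>W - {x}\<close>, for each \<open>x\<close>.
\<close>

definition spread :: "'a set set \<Rightarrow> 'a set \<Rightarrow> 'a set \<Rightarrow> bool" where
  "spread E W U \<longleftrightarrow> (\<forall>x\<in>W. \<forall>C. side E (W - {x}) C \<and> C \<noteq> {} \<longrightarrow> C \<inter> U \<noteq> {})"

lemma connected_edge_to_deleted:
  assumes conn: "connected_on E W" and v: "v \<in> W" and C: "side E (W - {v}) C" "C \<noteq> {}"
  shows "neighbours E W v \<inter> C \<noteq> {}"
proof
  assume n: "neighbours E W v \<inter> C = {}"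
  have CW: "C \<subseteq> W - {v}" using C(1) unfolding side_def by auto
  have "side E W C"
    unfolding side_def
  proof (intro conjI ballI)
    fix a b assume a: "a \<in> C" and b: "b \<in> W - C"
    show "{a, b} \<notin> E"
    proof (cases "b = v")
      case True
      then show ?thesis using a n CW unfolding neighbours_def by auto
    next
      case False
      then show ?thesis using side_no_edge[OF C(1) a] b by auto
    qed
  qed (use CW in auto)
  then show False using connected_onD[OF conn] C CW v by blast
qed

text \<open>
  Each component of \<open>W - {v}\<close> contains a neighbour of \<open>v\<close>, so the neighbours are split between
  components. This disposes of the second term of the recursion when \<open>v\<close> is a cut-vertex.
\<close>

lemma nucleus_sum_disconnected:
  assumes conn: "connected_on E W" and v: "v \<in> W" and ne: "W - {v} \<noteq> {}"
    and nc: "\<not> connected_on E (W - {v})"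
  shows "nucleus_sum E (U \<union> neighbours E W v) (W - {v}) = 0"
proof -
  obtain C where C: "side E (W - {v}) C" "C \<noteq> {}" "C \<noteq> W - {v}"
    using not_connected_onD[OF nc ne] by blast
  have CW: "C \<subseteq> W - {v}" using C(1) unfolding side_def by auto
  have ne': "(W - {v}) - C \<noteq> {}" using C(3) CW by auto
  show ?thesis
  proof (rule nucleus_sum_eq_0_if_side_splits[OF C(1)])
    show "(U \<union> neighbours E W v) \<inter> C \<noteq> {}"
      using connected_edge_to_deleted[OF conn v C(1,2)] by auto
    show "(U \<union> neighbours E W v) - C \<noteq> {}"
      using connected_edge_to_deleted[OF conn v side_Diff[OF C(1)] ne'] by auto
  qed
qed

text \<open>
  If a side \<open>C\<close> at \<open>x\<close> contains a cut-vertex \<open>w\<close>, then the vertices outside \<open>C\<close> remain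
  connected to \<open>x\<close> when \<open>w\<close> is removed, and every other component of \<open>W - {w}\<close> lies inside \<open>C\<close>.
\<close>

lemma smaller_side_at_separator:
  assumes conn: "connected_on E W" and C: "side E (W - {x}) C" and x: "x \<in> W"
    and w: "w \<in> C" "separates E W w"
  obtains D where "side E (W - {w}) D" "D \<noteq> {}" "D \<subset> C"
proof -
  have CW: "C \<subseteq> W - {x}" using C unfolding side_def by auto
  have nc: "\<not> connected_on E (W - {w})" "W - {w} \<noteq> {}" using w unfolding separates_def by auto
  obtain T where T: "side E (W - {w}) T" "T \<noteq> {}" "x \<notin> T"
    using not_connected_onD[OF nc, of x] by blast
  have TW: "T \<subseteq> W - {w}" using T unfolding side_def by auto
  have "side E W (T - C)"
    unfolding side_def
  proof (intro conjI ballI)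
    fix a b assume a: "a \<in> T - C" and b: "b \<in> W - (T - C)"
    show "{a, b} \<notin> E"
    proof (cases "b \<in> C")
      case True
      then have "{b, a} \<notin> E" using side_no_edge[OF C True] a T TW by auto
      then show ?thesis by (simp add: insert_commute)
    next
      case False
      then show ?thesis using side_no_edge[OF T(1), of a b] a b w by auto
    qed
  qed (use TW in auto)
  then have "T - C = {}" using connected_onD[OF conn] T x by blast
  then show thesis using that[OF T(1,2)] TW w by blast
qed

text \<open>
  Descend with the preceding lemma to a side that contains no cut-vertex, and from there to
  one of its components. The last conjunct preserves the information needed to obtain
  an end component.
\<close>

lemma side_without_separator:
  assumes conn: "connected_on E W" and fin: "finite W"
    and "x \<in> W" "side E (W - {x}) C" "C \<noteq> {}"
  shows "\<exists>y D. y \<in> W \<and> side E (W - {y}) D \<and> D \<noteq> {} \<and> D \<subseteq> C \<and> connected_on E D \<and>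
    (\<forall>w\<in>D. \<not> separates E W w) \<and> (separates E W x \<longrightarrow> separates E W y)"
  using assms(3-)
proof (induction "card C" arbitrary: C x rule: less_induct)
  case less
  have CW: "C \<subseteq> W - {x}" using less.prems unfolding side_def by auto
  have fC: "finite C" using CW fin finite_subset by blast
  show ?case
  proof (cases "\<exists>w\<in>C. separates E W w")
    case True
    then obtain w where w: "w \<in> C" "separates E W w" by auto
    obtain D where D: "side E (W - {w}) D" "D \<noteq> {}" "D \<subset> C"
      by (rule smaller_side_at_separator[OF conn less.prems(2,1) w])
    have "card D < card C" using D(3) fC psubset_card_mono by blast
    then show ?thesis
      using less.hyps[OF _ _ D(1,2)] D(3) w unfolding separates_def by (meson order.trans psubset_imp_subset)
  next
    case noncut: False
    show ?thesis
    proof (cases "connected_on E C")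
      case True
      then show ?thesis using less.prems noncut by blast
    next
      case False
      obtain D where D: "side E C D" "D \<noteq> {}" "D \<noteq> C"
        using not_connected_onD[OF False less.prems(3)] by blast
      have sub: "D \<subset> C" using D unfolding side_def by auto
      have "card D < card C" using sub fC psubset_card_mono by blast
      then show ?thesis
        using less.hyps[OF _ less.prems(1) side_side[OF less.prems(2) D(1)] D(2)] sub by blast
    qed
  qed
qed

text \<open>
  The recursion removes a vertex from \<open>U\<close> in its first term; in the second one \<open>U\<close> may grow,
  but \<open>W\<close> shrinks.
\<close>

lemma card_pair_induct:
  assumes "\<And>W U. (\<And>W' U'. card W' < card W \<or> card W' = card W \<and> card U' < card U \<Longrightarrow> P W' U') \<Longrightarrow> P W U"
  shows "P W U"
proof -
  have "case p of (W, U) \<Rightarrow> P W U" for p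
  proof (induction p rule: wf_induct[OF wf_measures[of "[card \<circ> fst, card \<circ> snd]"]])
    case (1 p)
    obtain W U where p: "p = (W, U)" by (cases p)
    have "P W U" by (rule assms) (use 1[rule_format, of "(W', U')" for W' U'] in \<open>simp add: p\<close>)
    then show ?case by (simp add: p)
  qed
  from this[of "(W, U)"] show ?thesis by simp
qed

lemma neighbours_subset: "\<forall>e\<in>E. card e = 2 \<Longrightarrow> neighbours E W v \<subseteq> W - {v}"
proof
  fix u assume two: "\<forall>e\<in>E. card e = 2" and u: "u \<in> neighbours E W v"
  have "card {u, v} = 2" using two u unfolding neighbours_def by blast
  then show "u \<in> W - {v}" using u unfolding neighbours_def by (cases "u = v") auto
qed

lemma nucleus_sum_remove:
  assumes "finite W" "\<forall>e\<in>E. card e = 2" "v \<in> U" "U \<subseteq> W"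
  shows "nucleus_sum E U W =
     nucleus_sum E (U - {v}) W + nucleus_sum E (U - {v} \<union> neighbours E W v) (W - {v})"
  using nucleus_sum_insert[OF assms(1,2), of v "U - {v}"] assms(3,4) by (auto simp: insert_absorb)

lemma nucleus_sum_nonneg:
  assumes "finite W" and two: "\<forall>e\<in>E. card e = 2" and "connected_on E W"
    and "U \<noteq> {}" "U \<subseteq> W"
  shows "nucleus_sum E U W \<ge> 0"
  using assms(1,3-)
proof (induction W U rule: card_pair_induct)
  case (1 W U)
  note fin = \<open>finite W\<close> and conn = \<open>connected_on E W\<close> and U = \<open>U \<noteq> {}\<close> \<open>U \<subseteq> W\<close>
  obtain v where v: "v \<in> U" using U by auto
  show ?case
  proof (cases "U = {v}")
    case True
    then show ?thesis using nucleus_sum_singleton[OF fin two conn] v U by simp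
  next
    case False
    then have U': "U - {v} \<noteq> {}" using v by auto
    have cU: "card (U - {v}) < card U" "card (W - {v}) < card W"
      using v U fin by (meson card_Diff1_less finite_subset subsetD)+
    have "nucleus_sum E (U - {v}) W \<ge> 0"
      by (rule "1.IH") (use cU fin conn U U' in auto)
    moreover have "nucleus_sum E (U - {v} \<union> neighbours E W v) (W - {v}) \<ge> 0"
    proof (cases "connected_on E (W - {v})")
      case True
      show ?thesis
        by (rule "1.IH") (use cU fin True U U' neighbours_subset[OF two] in auto)
    next
      case False
      then show ?thesis using nucleus_sum_disconnected[OF conn] v U U' by fastforce
    qed
    ultimately show ?thesis using nucleus_sum_remove[OF fin two v U(2)] by simp
  qed
qed

text \<open>
  A side at \<open>x\<close> after deletion of \<open>v\<close> either contains a neighbour of \<open>v\<close> or was a side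
  at \<open>x\<close> before. The vertex \<open>v\<close> itself is excluded from the hypothesis because one application
  takes \<open>U = {v}\<close>, which does not meet the sides at \<open>v\<close>.
\<close>

lemma spread_delete:
  assumes conn: "connected_on E W" and v: "v \<in> W"
    and spr: "\<And>x C. x \<in> W - {v} \<Longrightarrow> side E (W - {x}) C \<Longrightarrow> C \<noteq> {} \<Longrightarrow> C \<inter> U \<noteq> {}"
  shows "spread E (W - {v}) (U - {v} \<union> neighbours E W v)"
  unfolding spread_def
proof (intro ballI allI impI)
  fix x C assume x: "x \<in> W - {v}" and C: "side E (W - {v} - {x}) C \<and> C \<noteq> {}"
  have CW: "C \<subseteq> W - {v} - {x}" using C unfolding side_def by auto
  show "C \<inter> (U - {v} \<union> neighbours E W v) \<noteq> {}"
  proof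
    assume e: "C \<inter> (U - {v} \<union> neighbours E W v) = {}"
    have "side E (W - {x}) C"
      unfolding side_def
    proof (intro conjI ballI)
      fix a b assume a: "a \<in> C" and b: "b \<in> W - {x} - C"
      show "{a, b} \<notin> E"
      proof (cases "b = v")
        case True
        then show ?thesis using a e CW unfolding neighbours_def by auto
      next
        case False
        then show ?thesis using side_no_edge[of E _ C a b] C a b by auto
      qed
    qed (use CW in auto)
    then have "C \<inter> U \<noteq> {}" using spr x C by blast
    then show False using e CW by auto
  qed
qed

text \<open>
  A side that contains no cut-vertex exists, and it meets \<open>U\<close> in some \<open>v\<close>. As \<open>W - {v}\<close> stays
  connected, the second term of the recursion at \<open>v\<close> is positive by induction; the first one is
  nonnegative.
\<close>

lemma nucleus_sum_pos:
  assumes "finite W" and two: "\<forall>e\<in>E. card e = 2" and "connected_on E W"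
    and "U \<noteq> {}" "U \<subseteq> W" "spread E W U"
  shows "nucleus_sum E U W > 0"
  using assms(1,3-)
proof (induction "card W" arbitrary: W U rule: less_induct)
  case less
  note fin = \<open>finite W\<close> and conn = \<open>connected_on E W\<close> and U = \<open>U \<noteq> {}\<close> \<open>U \<subseteq> W\<close>
    and spr = \<open>spread E W U\<close>
  obtain x where x: "x \<in> U" using U by auto
  then have xW: "x \<in> W" using U by auto
  show ?case
  proof (cases "W = {x}")
    case True
    then show ?thesis using nucleus_sum_singleton[OF fin two conn xW] x U by (simp add: subset_singleton_iff)
  next
    case False
    then have "side E (W - {x}) (W - {x})" "W - {x} \<noteq> {}" using xW unfolding side_def by auto
    then obtain y D where D: "y \<in> W" "side E (W - {y}) D" "D \<noteq> {}" "\<forall>w\<in>D. \<not> separates E W w"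
      using side_without_separator[OF conn fin xW] by blast
    then obtain v where v: "v \<in> D" "v \<in> U" using spr unfolding spread_def by blast
    have y: "y \<in> W - {v}" using D v unfolding side_def by auto
    have vW: "v \<in> W" using v U by auto
    have connv: "connected_on E (W - {v})" using D(4) v y vW unfolding separates_def by auto
    have "side E (W - {v}) (W - {v})" unfolding side_def by auto
    then have U': "U - {v} \<noteq> {}" using spr vW y unfolding spread_def by blast
    have c: "card (W - {v}) < card W" using fin vW by (meson card_Diff1_less)
    have sprv: "spread E (W - {v}) (U - {v} \<union> neighbours E W v)"
      by (rule spread_delete[OF conn vW]) (use spr in \<open>auto simp: spread_def\<close>)
    have "nucleus_sum E (U - {v} \<union> neighbours E W v) (W - {v}) > 0"
      by (rule less.hyps[OF c _ connv _ _ sprv])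
        (use fin U U' neighbours_subset[OF two] in auto)
    moreover have "nucleus_sum E (U - {v}) W \<ge> 0"
      by (rule nucleus_sum_nonneg[OF fin two conn U']) (use U in auto)
    ultimately show ?thesis using nucleus_sum_remove[OF fin two v(2) U(2)] by simp
  qed
qed

text \<open>
  If \<open>U\<close> misses a side \<open>C\<close> at \<open>x\<close>, apply the recursion to some \<open>v \<in> U\<close> other than \<open>x\<close>. It lies
  outside \<open>C\<close> and is not adjacent to \<open>C\<close>, so in both terms the new \<open>U\<close> misses \<open>C\<close> again.
\<close>

lemma nucleus_sum_eq_0_if_not_spread:
  assumes "finite W" and two: "\<forall>e\<in>E. card e = 2" and "connected_on E W"
    and "U \<noteq> {}" "U \<subseteq> W" and "x \<in> W" "side E (W - {x}) C" "C \<noteq> {}" "C \<inter> U = {}"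
  shows "nucleus_sum E U W = 0"
  using assms(1,3-)
proof (induction W U rule: card_pair_induct)
  case (1 W U)
  note fin = \<open>finite W\<close> and conn = \<open>connected_on E W\<close> and U = \<open>U \<noteq> {}\<close> \<open>U \<subseteq> W\<close>
    and C = \<open>side E (W - {x}) C\<close> \<open>C \<noteq> {}\<close> \<open>C \<inter> U = {}\<close> and x = \<open>x \<in> W\<close>
  have CW: "C \<subseteq> W - {x}" using C(1) unfolding side_def by auto
  show ?case
  proof (cases "U \<subseteq> {x}")
    case True
    then have "U = {x}" using U by auto
    then show ?thesis using nucleus_sum_singleton[OF fin two conn x] CW C(2) by auto
  next
    case False
    \<comment> \<open>The case \<open>v = x\<close> must be avoided, since \<open>x\<close> may be adjacent to \<open>C\<close>.\<close>
    then obtain v where v: "v \<in> U" "v \<noteq> x" by auto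
    have vC: "v \<notin> C" using v C by auto
    have vW: "v \<in> W" using v U by auto
    have cU: "card (U - {v}) < card U" "card (W - {v}) < card W"
      using v U fin by (meson card_Diff1_less finite_subset subsetD)+
    have ne: "W - {v} \<noteq> {}" using x v by auto
    have nv: "neighbours E W v \<inter> C = {}"
    proof -
      have "{u, v} \<notin> E" if "u \<in> C" for u
        by (rule side_no_edge[OF C(1) that]) (use vW vC v in auto)
      then show ?thesis unfolding neighbours_def by auto
    qed
    show ?thesis
    proof (cases "U = {v}")
      case True
      then show ?thesis using nucleus_sum_singleton[OF fin two conn vW] ne by auto
    next
      case False
      then have U': "U - {v} \<noteq> {}" using v by auto
      have "nucleus_sum E (U - {v}) W = 0"
        by (rule "1.IH") (use cU fin conn U U' C x in auto)
      moreover have "nucleus_sum E (U - {v} \<union> neighbours E W v) (W - {v}) = 0"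
      proof (cases "connected_on E (W - {v})")
        case True
        have "side E (W - {v} - {x}) (C \<inter> (W - {v} - {x}))"
          by (rule side_Int[OF C(1)]) auto
        moreover have "C \<inter> (W - {v} - {x}) = C" using CW vC by auto
        ultimately have s: "side E (W - {v} - {x}) C" by simp
        show ?thesis
          by (rule "1.IH") (use cU fin True U U' neighbours_subset[OF two] s C x v nv in auto)
      next
        case False
        then show ?thesis using nucleus_sum_disconnected[OF conn vW ne] by auto
      qed
      ultimately show ?thesis using nucleus_sum_remove[OF fin two v(1) U(2)] by simp
    qed
  qed
qed

lemma nucleus_sum_pos_iff_spread:
  assumes "finite W" and two: "\<forall>e\<in>E. card e = 2" and "connected_on E W"
    and "U \<noteq> {}" "U \<subseteq> W"
  shows "nucleus_sum E U W > 0 \<longleftrightarrow> spread E W U"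
  using nucleus_sum_pos[OF assms] nucleus_sum_eq_0_if_not_spread[OF assms]
  unfolding spread_def by (metis less_irrefl)

lemma nucleus_sum_empty:
  assumes fin: "finite W" and two: "\<forall>e\<in>E. card e = 2" and conn: "connected_on E W"
    and q: "q \<in> W" "W \<noteq> {q}"
  shows "nucleus_sum E {} W = - nucleus_sum E (neighbours E W q) (W - {q})"
  using nucleus_sum_insert[OF fin two q(1), of "{}"] nucleus_sum_singleton[OF fin two conn q(1)] q(2)
  by simp

lemma nucleus_sum_empty_eq_0:
  assumes fin: "finite W" and two: "\<forall>e\<in>E. card e = 2" and conn: "connected_on E W"
    and q: "separates E W q"
  shows "nucleus_sum E {} W = 0"
proof -
  have q: "q \<in> W" "W - {q} \<noteq> {}" "\<not> connected_on E (W - {q})" using q unfolding separates_def by auto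
  then have "W \<noteq> {q}" by auto
  then show ?thesis
    using nucleus_sum_empty[OF fin two conn q(1)] nucleus_sum_disconnected[OF conn q, of "{}"] by simp
qed

lemma spread_nonseparable:
  assumes ns: "\<And>w. \<not> separates E W w" and U: "a \<in> U" "b \<in> U" "a \<noteq> b" and UW: "U \<subseteq> W"
  shows "spread E W U"
  unfolding spread_def
proof (intro ballI allI impI)
  fix x C assume x: "x \<in> W" and C: "side E (W - {x}) C \<and> C \<noteq> {}"
  have "C \<subseteq> W - {x}" using C unfolding side_def by auto
  then have "connected_on E (W - {x})" using ns[of x] C x unfolding separates_def by auto
  then have "C = W - {x}" using connected_onD C by metis
  then show "C \<inter> U \<noteq> {}" using U UW by auto
qed

text \<open>
  A side of \<open>W - {q}\<close> at \<open>x\<close> without a neighbour of \<open>q\<close> would be a side of \<open>W\<close> at \<open>x\<close>,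
  hence everything but \<open>x\<close>; but it does not contain \<open>q\<close>. So the neighbours of \<open>q\<close> are spread.
\<close>

lemma nucleus_sum_empty_neg:
  assumes fin: "finite W" and two: "\<forall>e\<in>E. card e = 2" and conn: "connected_on E W"
    and ns: "\<And>w. \<not> separates E W w" and q: "q \<in> W" "W \<noteq> {q}"
  shows "nucleus_sum E {} W < 0"
proof -
  have ne: "W - {q} \<noteq> {}" using q by auto
  have s: "side E (W - {q}) (W - {q})" unfolding side_def by auto
  have c: "connected_on E (W - {q})" using ns[of q] q ne unfolding separates_def by auto
  have n: "neighbours E W q \<noteq> {}" using connected_edge_to_deleted[OF conn q(1) s ne] by auto
  have "spread E (W - {q}) ({q} - {q} \<union> neighbours E W q)"
  proof (rule spread_delete[OF conn q(1)])
    fix x C assume x: "x \<in> W - {q}" and C: "side E (W - {x}) C" "C \<noteq> {}"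
    have "connected_on E (W - {x})" using ns[of x] x q(1) unfolding separates_def by auto
    then have "C = W - {x}" using connected_onD C by metis
    then show "C \<inter> {q} \<noteq> {}" using x q by auto
  qed
  then have "spread E (W - {q}) (neighbours E W q)" by simp
  then have "nucleus_sum E (neighbours E W q) (W - {q}) > 0"
    by (intro nucleus_sum_pos[OF _ two c n neighbours_subset[OF two]]) (use fin in auto)
  then show ?thesis using nucleus_sum_empty[OF fin two conn q] by simp
qed

section \<open>Connected graphs, cut-vertices and Elser numbers in terms of sides\<close>

lemma connected_graph_iff:
  assumes "simple_graph H"
  shows "connected_graph H \<longleftrightarrow> connected_on (gedges H) (gverts H)"
proof
  let ?V = "gverts H" and ?R = "{(a, b). {a, b} \<in> gedges H}"
  have inV: "b \<in> ?V" if "{a, b} \<in> gedges H" for a b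
    using assms that unfolding simple_graph_def by auto
  {
    assume conn: "connected_graph H"
    have "C = ?V" if C: "side (gedges H) ?V C" "u \<in> C" for C u
    proof -
      have CV: "C \<subseteq> ?V" using C unfolding side_def by auto
      have "v \<in> C" if "v \<in> ?V" for v
      proof -
        have "(u, v) \<in> ?R\<^sup>*" using conn that C CV unfolding connected_graph_def reach_rel_def by auto
        then show ?thesis
        proof (induction rule: rtrancl_induct)
          case (step y z)
          then show ?case using side_no_edge[OF C(1), of y z] inV[of y z] by auto
        qed (rule C(2))
      qed
      then show ?thesis using CV by auto
    qed
    then show "connected_on (gedges H) ?V"
      using conn unfolding connected_on_def connected_graph_def by blast
  next
    assume conn: "connected_on (gedges H) ?V"
    have "(u, v) \<in> ?R\<^sup>*" if u: "u \<in> ?V" and v: "v \<in> ?V" for u v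
    proof -
      let ?C = "{v \<in> ?V. (u, v) \<in> ?R\<^sup>*}"
      have "side (gedges H) ?V ?C"
        unfolding side_def
      proof (intro conjI ballI notI)
        fix a b assume ab: "a \<in> ?C" "b \<in> ?V - ?C" "{a, b} \<in> gedges H"
        have "(u, a) \<in> ?R\<^sup>*" "(a, b) \<in> ?R" using ab(1,3) by simp_all
        then have "(u, b) \<in> ?R\<^sup>*" by (rule rtrancl_into_rtrancl)
        then show False using ab(2) by simp
      qed simp
      then have "?C = ?V" using connected_onD[OF conn] u by blast
      then show ?thesis using v by blast
    qed
    moreover have "?V \<noteq> {}" using conn unfolding connected_on_def by blast
    ultimately show "connected_graph H"
      unfolding connected_graph_def reach_rel_def by simp
  }
qed

lemma card_components_connected:
  assumes "connected_graph H"
  shows "card (components_of_graph H) = 1"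
proof -
  have "reach_rel H `` {u} = gverts H" if "u \<in> gverts H" for u
    using assms that unfolding connected_graph_def reach_rel_def by auto
  then have "components_of_graph H = {gverts H}"
    using assms unfolding components_of_graph_def quotient_def connected_graph_def by auto
  then show ?thesis by simp
qed

lemma card_components_disconnected:
  assumes "finite (gverts H)" "gverts H \<noteq> {}" "\<not> connected_graph H"
  shows "card (components_of_graph H) \<ge> 2"
proof -
  let ?R = "reach_rel H"
  obtain u v where uv: "u \<in> gverts H" "v \<in> gverts H" "(u, v) \<notin> ?R"
    using assms unfolding connected_graph_def by auto
  have "(v, v) \<in> ?R" using uv unfolding reach_rel_def by auto
  then have ne: "?R `` {u} \<noteq> ?R `` {v}" using uv by blast
  have "{?R `` {u}, ?R `` {v}} \<subseteq> components_of_graph H"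
    using uv unfolding components_of_graph_def by (auto intro: quotientI)
  moreover have "finite (components_of_graph H)"
    unfolding components_of_graph_def quotient_def using assms(1) by auto
  ultimately have "card {?R `` {u}, ?R `` {v}} \<le> card (components_of_graph H)" by (rule card_mono[rotated])
  then show ?thesis using ne by simp
qed

lemma cut_vertex_iff:
  assumes H: "simple_graph H" and conn: "connected_graph H"
  shows "cut_vertex H x \<longleftrightarrow> separates (gedges H) (gverts H) x"
proof -
  let ?D = "delete_vertex H x"
  have D: "simple_graph ?D" using H unfolding simple_graph_def delete_vertex_def by auto
  have V: "gverts ?D = gverts H - {x}" unfolding delete_vertex_def by simp
  have "connected_on (gedges ?D) (gverts H - {x}) = connected_on (gedges H) (gverts H - {x})"
    by (rule connected_on_cong) (auto simp: delete_vertex_def)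
  then have c: "connected_graph ?D \<longleftrightarrow> connected_on (gedges H) (gverts H - {x})"
    using connected_graph_iff[OF D] V by simp
  have f: "finite (gverts ?D)" using D unfolding simple_graph_def by simp
  have 1: "card (components_of_graph H) = 1" using card_components_connected[OF conn] .
  have "card (components_of_graph ?D) > 1 \<longleftrightarrow> gverts ?D \<noteq> {} \<and> \<not> connected_graph ?D"
  proof (cases "gverts ?D = {}")
    case True
    then show ?thesis unfolding components_of_graph_def quotient_def by simp
  next
    case False
    then show ?thesis using card_components_connected[of ?D] card_components_disconnected[OF f] by force
  qed
  then show ?thesis using c V 1 unfolding cut_vertex_def separates_def by simp
qed

lemma nuclei_eq:
  assumes G: "simple_graph G"
  shows "nuclei G = (SIGMA S:{S. S \<subseteq> gverts G \<and> edges_in (gedges G) (gverts G - S) = {}}.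
     {A. A \<subseteq> edges_in (gedges G) S \<and> connected_on A S})"
proof -
  have iff: "(S, A) \<in> nuclei G \<longleftrightarrow> (S \<subseteq> gverts G \<and> edges_in (gedges G) (gverts G - S) = {}) \<and>
     A \<subseteq> edges_in (gedges G) S \<and> connected_on A S" for S A
  proof -
    have sub: "subgraph_of (S, A) G \<longleftrightarrow> S \<subseteq> gverts G \<and> A \<subseteq> edges_in (gedges G) S"
      using G unfolding subgraph_of_def simple_graph_def edges_in_def by (auto intro: finite_subset)
    have cov: "(\<forall>e\<in>gedges G. e \<inter> S \<noteq> {}) \<longleftrightarrow> edges_in (gedges G) (gverts G - S) = {}"
    proof -
      have "e \<inter> S \<noteq> {} \<longleftrightarrow> \<not> e \<subseteq> gverts G - S" if "e \<in> gedges G" for e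
      proof -
        have "e \<subseteq> gverts G" using G that unfolding simple_graph_def by simp
        then show ?thesis by blast
      qed
      then show ?thesis unfolding edges_in_def Collect_empty_eq by (simp add: Ball_def)
    qed
    show ?thesis
    proof (cases "subgraph_of (S, A) G")
      case True
      then have "simple_graph (S, A)" unfolding subgraph_of_def by simp
      then have "connected_graph (S, A) \<longleftrightarrow> connected_on A S" using connected_graph_iff by fastforce
      then show ?thesis using True sub cov unfolding nuclei_def by auto
    qed (use sub in \<open>auto simp: nuclei_def\<close>)
  qed
  show ?thesis
  proof (rule set_eqI)
    fix N :: "'a ugraph"
    show "N \<in> nuclei G \<longleftrightarrow> N \<in> (SIGMA S:{S. S \<subseteq> gverts G \<and> edges_in (gedges G) (gverts G - S) = {}}.
     {A. A \<subseteq> edges_in (gedges G) S \<and> connected_on A S})"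
      by (cases N) (simp only: iff mem_Sigma_iff mem_Collect_eq)
  qed
qed

text \<open>
  Expanding \<open>\<bar>S\<bar>^k\<close> into lists replaces the usual expansion by surjections: a list contributes
  through its set of entries.
\<close>

lemma els_eq_sum_lists:
  assumes G: "simple_graph G"
  shows "els k G = (\<Sum>xs | set xs \<subseteq> gverts G \<and> length xs = k. nucleus_sum (gedges G) (set xs) (gverts G))"
proof -
  let ?V = "gverts G" and ?E = "gedges G"
  let ?Cov = "{S. S \<subseteq> ?V \<and> edges_in ?E (?V - S) = {}}"
  let ?L = "{xs. set xs \<subseteq> ?V \<and> length xs = k}"
  have fin: "finite ?V" using G unfolding simple_graph_def by simp
  have fC: "finite ?Cov" by (rule finite_subset[of _ "Pow ?V"]) (use fin in auto)
  have fL: "finite ?L" using finite_lists_length_eq[OF fin] .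
  have fA: "finite {A. A \<subseteq> edges_in ?E S \<and> connected_on A S}" if "S \<in> ?Cov" for S
    by (rule finite_subset[of _ "Pow (edges_in ?E S)"])
      (use that fin finite_edges_in finite_subset in auto)
  have pow: "int (card S) ^ k = (\<Sum>xs | xs \<in> ?L \<and> set xs \<subseteq> S. 1)" if S: "S \<in> ?Cov" for S
  proof -
    have "{xs. xs \<in> ?L \<and> set xs \<subseteq> S} = {xs. set xs \<subseteq> S \<and> length xs = k}" using S by auto
    moreover have "card {xs. set xs \<subseteq> S \<and> length xs = k} = card S ^ k"
      by (rule card_lists_length_eq) (use S fin finite_subset in auto)
    ultimately show ?thesis by simp
  qed
  have "(\<Sum>N\<in>nuclei G. (- 1) ^ card (gedges N) * int (card (gverts N)) ^ k)
      = (\<Sum>(S, A)\<in>(SIGMA S:?Cov. {A. A \<subseteq> edges_in ?E S \<and> connected_on A S}).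
          (- 1) ^ card A * int (card S) ^ k)"
    unfolding nuclei_eq[OF G] by (rule sum.cong) auto
  also have "\<dots> = (\<Sum>S\<in>?Cov. \<Sum>A | A \<subseteq> edges_in ?E S \<and> connected_on A S. (- 1) ^ card A * int (card S) ^ k)"
    by (rule sum.Sigma[symmetric]) (use fC fA in auto)
  also have "\<dots> = (\<Sum>S\<in>?Cov. connected_sum ?E S * int (card S) ^ k)"
    unfolding connected_sum_def by (simp add: sum_distrib_right)
  also have "\<dots> = (\<Sum>S\<in>?Cov. \<Sum>xs | xs \<in> ?L \<and> set xs \<subseteq> S. connected_sum ?E S)"
    by (rule sum.cong[OF refl]) (simp add: pow)
  also have "\<dots> = (\<Sum>xs\<in>?L. \<Sum>S | S \<in> ?Cov \<and> set xs \<subseteq> S. connected_sum ?E S)"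
    using sum.swap_restrict[OF fC fL] .
  finally have *: "(\<Sum>N\<in>nuclei G. (- 1) ^ card (gedges N) * int (card (gverts N)) ^ k) = \<dots>" .
  have "els k G = (\<Sum>xs\<in>?L. (- 1) ^ (card ?V + 1) * (\<Sum>S | S \<in> ?Cov \<and> set xs \<subseteq> S. connected_sum ?E S))"
    unfolding els_def * by (rule sum_distrib_left)
  also have "\<dots> = (\<Sum>xs\<in>?L. nucleus_sum ?E (set xs) ?V)"
    unfolding nucleus_sum_def by (intro sum.cong refl arg_cong2[of _ _ _ _ "(*)"]) auto
  finally show ?thesis .
qed

section \<open>Blocks and end components\<close>

definition nonseparable :: "'a set set \<Rightarrow> 'a set \<Rightarrow> bool" where
  "nonseparable E W \<longleftrightarrow> connected_on E W \<and> (\<forall>x. \<not> separates E W x)"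

definition block_set :: "'a set set \<Rightarrow> 'a set \<Rightarrow> 'a set \<Rightarrow> bool" where
  "block_set E V W \<longleftrightarrow> W \<subseteq> V \<and> nonseparable E W \<and>
     (\<forall>W'. W \<subseteq> W' \<and> W' \<subseteq> V \<and> nonseparable E W' \<longrightarrow> W' = W)"

lemma nonseparable_mono:
  assumes "nonseparable A W" "A \<subseteq> E"
  shows "nonseparable E W"
  using assms connected_on_mono[OF _ assms(2)] unfolding nonseparable_def separates_def by metis

lemma nonseparable_edges_in: "nonseparable (edges_in E W) W \<longleftrightarrow> nonseparable E W"
proof -
  have "connected_on (edges_in E W) X \<longleftrightarrow> connected_on E X" if "X \<subseteq> W" for X
    by (rule connected_on_cong) (use that in \<open>auto simp: edges_in_def\<close>)
  then have "connected_on (edges_in E W) W \<longleftrightarrow> connected_on E W"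
    "\<And>x. connected_on (edges_in E W) (W - {x}) \<longleftrightarrow> connected_on E (W - {x})" by blast+
  then show ?thesis unfolding nonseparable_def separates_def by simp
qed

lemma connected_without_cut_vertex_iff:
  assumes "simple_graph H"
  shows "connected_graph H \<and> (\<nexists>x. cut_vertex H x) \<longleftrightarrow> nonseparable (gedges H) (gverts H)"
  using cut_vertex_iff[OF assms] connected_graph_iff[OF assms] unfolding nonseparable_def by auto

lemma subgraph_induced:
  assumes "simple_graph G" "W \<subseteq> gverts G"
  shows "subgraph_of (W, edges_in (gedges G) W) G"
  using assms unfolding subgraph_of_def simple_graph_def edges_in_def by (auto intro: finite_subset)

lemma subgraph_ofD:
  assumes "subgraph_of H G"
  shows "simple_graph H" "gverts H \<subseteq> gverts G" "gedges H \<subseteq> edges_in (gedges G) (gverts H)"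
  using assms unfolding subgraph_of_def simple_graph_def edges_in_def by auto

text \<open>
  Adding edges between vertices of a connected graph without cut-vertex preserves both
  properties, so blocks are induced subgraphs and are determined by their vertex sets.
\<close>

lemma blocks_eq:
  assumes G: "simple_graph G"
  shows "blocks G = (\<lambda>W. (W, edges_in (gedges G) W)) ` {W. block_set (gedges G) (gverts G) W}"
proof (intro set_eqI iffI)
  let ?E = "gedges G" and ?V = "gverts G"
  let ?ind = "\<lambda>W. (W, edges_in ?E W)"
  have nsi: "connected_graph (?ind W) \<and> (\<nexists>x. cut_vertex (?ind W) x) \<longleftrightarrow> nonseparable ?E W"
    if "W \<subseteq> ?V" for W
    using connected_without_cut_vertex_iff[OF subgraph_ofD(1)[OF subgraph_induced[OF G that]]]
      nonseparable_edges_in[of ?E W] by simp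
  {
    fix B assume B: "B \<in> blocks G"
    let ?W = "gverts B"
    have sub: "subgraph_of B G" and cc: "connected_graph B \<and> (\<nexists>x. cut_vertex B x)"
      using B unfolding blocks_def mem_Collect_eq by blast+
    have max: "B' = B" if "subgraph_of B' G" "connected_graph B' \<and> (\<nexists>x. cut_vertex B' x)" "subgraph_of B B'" for B'
      using B that unfolding blocks_def mem_Collect_eq by blast
    note sB = subgraph_ofD[OF sub]
    have ns: "nonseparable (gedges B) ?W"
      using cc connected_without_cut_vertex_iff[OF sB(1)] by blast
    have nsE: "nonseparable ?E ?W"
      by (rule nonseparable_mono[OF ns]) (use sB(3) in \<open>auto simp: edges_in_def\<close>)
    have ext: "?ind W' = B" if W': "?W \<subseteq> W'" "W' \<subseteq> ?V" "nonseparable ?E W'" for W'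
    proof (rule max)
      show "subgraph_of (?ind W') G" using subgraph_induced[OF G W'(2)] .
      show "subgraph_of B (?ind W')"
        using sB W'(1) unfolding subgraph_of_def edges_in_def by auto
    qed (use nsi W' in blast)
    have "?ind ?W = B" using ext[OF subset_refl sB(2) nsE] .
    moreover have "W' = ?W" if W': "?W \<subseteq> W'" "W' \<subseteq> ?V" "nonseparable ?E W'" for W'
      using ext[OF W'] by (metis fst_conv)
    ultimately show "B \<in> ?ind ` {W. block_set ?E ?V W}"
      using sB(2) nsE unfolding block_set_def by (intro image_eqI[of _ _ ?W]) auto
  next
    fix B assume "B \<in> ?ind ` {W. block_set ?E ?V W}"
    then obtain W where B: "B = ?ind W" and W: "block_set ?E ?V W" by auto
    have WV: "W \<subseteq> ?V" and ns: "nonseparable ?E W"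
      and max: "\<And>W'. W \<subseteq> W' \<Longrightarrow> W' \<subseteq> ?V \<Longrightarrow> nonseparable ?E W' \<Longrightarrow> W' = W"
      using W unfolding block_set_def by auto
    have "B' = B" if B': "subgraph_of B' G" "connected_graph B'" "\<nexists>x. cut_vertex B' x" "subgraph_of B B'" for B'
    proof -
      note s = subgraph_ofD[OF B'(1)]
      have "nonseparable (gedges B') (gverts B')"
        using connected_without_cut_vertex_iff[OF s(1)] B' by blast
      then have "nonseparable ?E (gverts B')"
        by (rule nonseparable_mono) (use s(3) in \<open>auto simp: edges_in_def\<close>)
      moreover have "W \<subseteq> gverts B'" "edges_in ?E W \<subseteq> gedges B'"
        using B'(4) B unfolding subgraph_of_def by auto
      ultimately show ?thesis using max[of "gverts B'"] s B by (metis prod.collapse subset_antisym)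
    qed
    then show "B \<in> blocks G"
      using B nsi[OF WV] ns subgraph_induced[OF G WV] unfolding blocks_def by blast
  }
qed

definition end_component :: "'a set set \<Rightarrow> 'a set \<Rightarrow> 'a \<Rightarrow> 'a set \<Rightarrow> bool" where
  "end_component E V x C \<longleftrightarrow> separates E V x \<and> side E (V - {x}) C \<and> C \<noteq> {} \<and>
     connected_on E C \<and> (\<forall>y\<in>C. \<not> separates E V y)"

lemma end_component_exists:
  assumes conn: "connected_on E V" and fin: "finite V" and x: "separates E V x"
    and C: "side E (V - {x}) C" "C \<noteq> {}"
  shows "\<exists>y D. end_component E V y D \<and> D \<subseteq> C"
proof -
  have xV: "x \<in> V" using x unfolding separates_def by simp
  show ?thesis
    using side_without_separator[OF conn fin xV C] x unfolding end_component_def by blast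
qed

lemma connected_side_subset:
  assumes "connected_on E X" "X \<subseteq> W" "side E W C" "X \<inter> C \<noteq> {}"
  shows "X \<subseteq> C"
  using connected_onD[OF assms(1) side_Int[OF assms(3,2) subset_refl]] assms(4) by blast

text \<open>
  An end component avoids the cut-vertex at which another one is attached, so it stays connected
  when that vertex is removed and lies in a single component there.
\<close>

lemma end_components_eq:
  assumes C: "end_component E V x C" and D: "end_component E V y D" and CD: "C \<inter> D \<noteq> {}"
  shows "C = D"
proof -
  have "A \<subseteq> B" if A: "end_component E V a A" and B: "end_component E V b B" and AB: "A \<inter> B \<noteq> {}" for A B a b
  proof (rule connected_side_subset)
    show "connected_on E A" "side E (V - {b}) B" using A B unfolding end_component_def by auto
    have "A \<subseteq> V" using A unfolding end_component_def side_def by auto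
    moreover have "b \<notin> A" using A B unfolding end_component_def by auto
    ultimately show "A \<subseteq> V - {b}" by auto
  qed (rule AB)
  from this[OF C D] this[OF D C] CD show ?thesis by auto
qed

lemma end_component_insert_connected:
  assumes conn: "connected_on E V" and C: "end_component E V x C" 
  shows "connected_on E (insert x C)"
proof (rule connected_onI_avoiding)
  fix T assume T: "side E (insert x C) T" "x \<notin> T"
  have s: "side E (V - {x}) C" and xV: "x \<in> V" using C unfolding end_component_def separates_def by auto
  have CV: "C \<subseteq> V - {x}" using s unfolding side_def by auto
  have TC: "T \<subseteq> C" using T unfolding side_def by auto
  have "side E V T"
    unfolding side_def
  proof (intro conjI ballI)
    fix a b assume a: "a \<in> T" and b: "b \<in> V - T"
    show "{a, b} \<notin> E"
    proof (cases "b \<in> insert x C")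
      case True
      then show ?thesis using side_no_edge[OF T(1) a] b by auto
    next
      case False
      then show ?thesis using side_no_edge[OF s, of a b] a b TC by auto
    qed
  qed (use TC CV in auto)
  then show "T = {}" using connected_onD[OF conn] T(2) xV by blast
qed simp

text \<open>
  The rest of the graph is attached to \<open>C\<close> through \<open>x\<close> only. So a side of the small graph that
  avoids \<open>x\<close> is a side of the whole graph as well, after deletion of \<open>y\<close> as before.
\<close>

lemma end_component_insert_nonseparable:
  assumes conn: "connected_on E V" and C: "end_component E V x C" 
  shows "nonseparable E (insert x C)"
  unfolding nonseparable_def
proof (intro conjI allI notI)
  show "connected_on E (insert x C)" using end_component_insert_connected[OF assms] .
  have s: "side E (V - {x}) C" and xV: "x \<in> V" using C unfolding end_component_def separates_def by auto
  have CV: "C \<subseteq> V - {x}" using s unfolding side_def by auto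
  fix y assume y: "separates E (insert x C) y"
  then have yc: "\<not> connected_on E (insert x C - {y})" "y \<in> insert x C" unfolding separates_def by auto
  show False
  proof (cases "y = x")
    case True
    then have "insert x C - {y} = C" using CV by auto
    then show False using yc C unfolding end_component_def by auto
  next
    case False
    then have yC: "y \<in> C" using yc by auto
    have yV: "y \<in> V" "x \<in> V - {y}" using yC CV xV by auto
    have connV: "connected_on E (V - {y})"
      using C yC yV unfolding end_component_def separates_def by blast
    have "connected_on E (insert x C - {y})"
    proof (rule connected_onI_avoiding)
      show "x \<in> insert x C - {y}" using False by auto
      fix T assume T: "side E (insert x C - {y}) T" "x \<notin> T"
      have TC: "T \<subseteq> C - {y}" using T unfolding side_def by auto
      have "side E (V - {y}) T"
        unfolding side_def
      proof (intro conjI ballI)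
        fix a b assume a: "a \<in> T" and b: "b \<in> V - {y} - T"
        show "{a, b} \<notin> E"
        proof (cases "b \<in> insert x C")
          case True
          then show ?thesis using side_no_edge[OF T(1) a] b by auto
        next
          case False
          then show ?thesis using side_no_edge[OF s, of a b] a b TC by auto
        qed
      qed (use TC CV in auto)
      then show "T = {}" using connected_onD[OF connV] T(2) yV(2) by blast
    qed
    then show False using yc by simp
  qed
qed

lemma end_component_block_set:
  assumes conn: "connected_on E V" and C: "end_component E V x C" 
  shows "block_set E V (insert x C)"
  unfolding block_set_def
proof (intro conjI allI impI)
  have s: "side E (V - {x}) C" and xV: "x \<in> V" using C unfolding end_component_def separates_def by auto
  have CV: "C \<subseteq> V - {x}" and Cne: "C \<noteq> {}" using s C unfolding side_def end_component_def by auto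
  show "insert x C \<subseteq> V" using CV xV by auto
  show "nonseparable E (insert x C)" using end_component_insert_nonseparable[OF assms] .
  fix W assume W: "insert x C \<subseteq> W \<and> W \<subseteq> V \<and> nonseparable E W"
  have ne: "W - {x} \<noteq> {}" and x: "x \<in> W" using W Cne CV by auto
  have c: "connected_on E (W - {x})" using W ne x unfolding nonseparable_def separates_def by blast
  have "W - {x} \<subseteq> C"
    by (rule connected_side_subset[OF c _ s]) (use W Cne CV in auto)
  then show "W = insert x C" using W by auto
qed

text \<open>
  The conclusion, with \<open>z\<close> and \<open>T\<close> arbitrary, says that passing to the subset of \<open>V\<close> does not
  disconnect vertices that are connected in \<open>V - {z}\<close>. This property survives intersection with a half
  \<open>insert y D\<close>: what lies outside the half is attached to it through \<open>y\<close> only, so it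
  can be added to the side that contains \<open>y\<close>.
\<close>

lemma side_extends_from_half:
  assumes ext: "\<And>T. side E (X - {z}) T \<Longrightarrow> \<exists>T'. side E (V - {z}) T' \<and> T' \<inter> X = T"
    and XV: "X \<subseteq> V" and D: "side E (V - {y}) D"
    and T: "side E (X \<inter> insert y D - {z}) T"
  shows "\<exists>T'. side E (V - {z}) T' \<and> T' \<inter> (X \<inter> insert y D) = T"
proof -
  let ?H = "insert y D"
  \<comment> \<open>Vertices outside the half are on the side of \<open>y\<close>, whether or not \<open>y\<close> belongs to \<open>T\<close>.\<close>
  define T1 where "T1 = (if y \<in> T then T \<union> (X - {z} - ?H) else T)"
  have TX: "T \<subseteq> X \<inter> ?H - {z}" using T unfolding side_def by auto
  have DV: "D \<subseteq> V - {y}" using D unfolding side_def by auto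
  have cross: "{a, b} \<notin> E" if "a \<in> D" "b \<in> X" "b \<notin> ?H" for a b
    by (rule side_no_edge[OF D]) (use that XV in auto)
  have "side E (X - {z}) T1"
    unfolding side_def
  proof (intro conjI ballI)
    show "T1 \<subseteq> X - {z}" using TX unfolding T1_def by auto
    fix a b assume a: "a \<in> T1" and b: "b \<in> X - {z} - T1"
    show "{a, b} \<notin> E"
    proof (cases "a \<in> T \<and> b \<in> ?H")
      case True
      have "b \<notin> T" using b unfolding T1_def by (auto split: if_splits)
      then show ?thesis using side_no_edge[OF T, of a b] True b by auto
    next
      case False
      show ?thesis
      proof (cases "y \<in> T")
        case True
        then have "b \<in> ?H" "b \<notin> T" using b unfolding T1_def by auto
        then have "b \<in> D" "a \<in> X" "a \<notin> ?H" using a True \<open>\<not> (a \<in> T \<and> b \<in> ?H)\<close> unfolding T1_def by auto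
        then have "{b, a} \<notin> E" by (rule cross)
        then show ?thesis by (simp add: insert_commute)
      next
        case yT: False
        then have "a \<in> T" using a unfolding T1_def by simp
        then have "a \<in> D" "b \<in> X" "b \<notin> ?H" using TX yT False b by auto
        then show ?thesis by (rule cross)
      qed
    qed
  qed
  then obtain T' where T': "side E (V - {z}) T'" "T' \<inter> X = T1" using ext by blast
  have "T1 \<inter> ?H = T" using TX unfolding T1_def by auto
  then have "T' \<inter> (X \<inter> ?H) = T" using T'(2) by auto
  then show ?thesis using T'(1) by blast
qed

text \<open>Some components of \<open>V - {y}\<close>, together with \<open>y\<close>.\<close>

definition half :: "'a set set \<Rightarrow> 'a set \<Rightarrow> 'a set \<Rightarrow> bool" where
  "half E V H \<longleftrightarrow> (\<exists>y D. y \<in> V \<and> side E (V - {y}) D \<and> H = insert y D)"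

lemma side_extends_from_halves:
  assumes "finite F" "\<And>H. H \<in> F \<Longrightarrow> half E V H" and "side E (V \<inter> \<Inter>F - {z}) T"
  shows "\<exists>T'. side E (V - {z}) T' \<and> T' \<inter> (V \<inter> \<Inter>F) = T"
  using assms
proof (induction F arbitrary: T rule: finite_induct)
  case empty
  then show ?case unfolding side_def by (intro exI[of _ T]) auto
next
  case (insert H F)
  obtain y D where D: "side E (V - {y}) D" "H = insert y D"
    using insert.prems(1)[of H] unfolding half_def by blast
  have eq: "V \<inter> \<Inter>(insert H F) = V \<inter> \<Inter>F \<inter> insert y D" using D(2) by auto
  show ?case
    unfolding eq
  proof (rule side_extends_from_half[OF _ _ D(1)])
    fix T assume "side E (V \<inter> \<Inter>F - {z}) T"
    then show "\<exists>T'. side E (V - {z}) T' \<and> T' \<inter> (V \<inter> \<Inter>F) = T"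
      using insert.IH insert.prems(1) by blast
  next
    show "side E (V \<inter> \<Inter>F \<inter> insert y D - {z}) T" using insert.prems(2) unfolding eq .
  qed simp
qed

text \<open>
  Suppose that a side \<open>T\<close> separates the intersection after deletion of \<open>z\<close>. It extends to a side of
  \<open>V - {z}\<close>, and the connected set \<open>W - {z}\<close> lies within that side or within its complement.
  Together with \<open>z\<close> this gives a half that contains \<open>W\<close> but not the whole intersection,
  a contradiction. Choosing \<open>z\<close> outside the intersection gives the connectedness of the intersection itself.
\<close>

lemma nonseparable_Inter_halves:
  assumes conn: "connected_on E V" and fin: "finite V" and ns: "nonseparable E W" and WV: "W \<subseteq> V"
  shows "nonseparable E (V \<inter> \<Inter>{H. half E V H \<and> W \<subseteq> H})"
proof -
  let ?F = "{H. half E V H \<and> W \<subseteq> H}"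
  let ?X = "V \<inter> \<Inter>?F"
  have fF: "finite ?F"
    by (rule finite_subset[of _ "Pow V"]) (use fin in \<open>auto simp: half_def side_def\<close>)
  have WX: "W \<subseteq> ?X" using WV by auto
  have Wne: "W \<noteq> {}" using ns unfolding nonseparable_def connected_on_def by auto
  have ext: "\<exists>T'. side E (V - {z}) T' \<and> T' \<inter> ?X = T" if "side E (?X - {z}) T" for z T
    by (rule side_extends_from_halves[OF fF _ that]) simp
  have "connected_on E (?X - {z})" if z: "?X - {z} \<noteq> {}" for z
    unfolding connected_on_def
  proof (intro conjI allI impI)
    show "?X - {z} \<noteq> {}" by (rule z)
    fix T assume T: "side E (?X - {z}) T"
    obtain T' where T': "side E (V - {z}) T'" "T' \<inter> ?X = T" using ext[OF T] by blast
    have T'V: "T' \<subseteq> V - {z}" using T'(1) unfolding side_def by auto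
    show "T = {} \<or> T = ?X - {z}"
    proof (cases "z \<in> V")
      case False
      then have "side E V T'" using T'(1) by simp
      then have "T' = {} \<or> T' = V" using connected_onD[OF conn] by blast
      then show ?thesis using T'(2) False by blast
    next
      case True
      have Wz: "W - {z} \<subseteq> T' \<or> (W - {z}) \<inter> T' = {}"
      proof (cases "connected_on E (W - {z})")
        case True
        then show ?thesis using connected_side_subset[OF True _ T'(1)] WV by blast
      next
        case False
        then have "W - {z} = {}"
          using ns unfolding nonseparable_def separates_def by (cases "z \<in> W") auto
        then show ?thesis by blast
      qed
      then show ?thesis
      proof
        assume "W - {z} \<subseteq> T'"
        then have "insert z T' \<in> ?F" using T'(1) True unfolding half_def by auto
        then have "?X \<subseteq> insert z T'" by blast
        then show ?thesis using T'(2) T'V by blast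
      next
        assume e: "(W - {z}) \<inter> T' = {}"
        have "half E V (insert z (V - {z} - T'))"
          unfolding half_def using side_Diff[OF T'(1)] True by blast
        then have "insert z (V - {z} - T') \<in> ?F" using e WV by auto
        then have "?X \<subseteq> insert z (V - {z} - T')" by blast
        then show ?thesis using T'(2) T'V by blast
      qed
    qed
  qed
  note c = this
  have Xne: "?X \<noteq> {}" using WX Wne by auto
  have "connected_on E ?X"
  proof (cases "\<exists>z. z \<notin> ?X")
    case True
    then obtain z where "z \<notin> ?X" by auto
    then have "?X - {z} = ?X" by blast
    then show ?thesis using c[of z] Xne by simp
  next
    case False
    then have "?X = UNIV" by auto
    then have "?X = V" using WV by auto
    then show ?thesis using conn by simp
  qed
  then show ?thesis using c unfolding nonseparable_def separates_def by blast
qed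

text \<open>
  By maximality a block is the intersection of the halves containing it. So some half,
  cut off at a vertex \<open>p\<close>, contains \<open>W\<close> but not \<open>z\<close>, and the edge from \<open>y\<close> to \<open>z\<close> forces \<open>p = y\<close>; so \<open>y\<close> separates
  \<open>x\<close> from \<open>z\<close>.
\<close>

lemma block_set_edge_leaving:
  assumes conn: "connected_on E V" and fin: "finite V" and W: "block_set E V W"
    and y: "y \<in> W" and z: "z \<in> V" "z \<notin> W" "{y, z} \<in> E" and x: "x \<in> W" "x \<noteq> y"
  shows "separates E V y"
proof -
  have WV: "W \<subseteq> V" and ns: "nonseparable E W"
    and max: "\<And>W'. W \<subseteq> W' \<Longrightarrow> W' \<subseteq> V \<Longrightarrow> nonseparable E W' \<Longrightarrow> W' = W"
    using W unfolding block_set_def by auto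
  let ?X = "V \<inter> \<Inter>{H. half E V H \<and> W \<subseteq> H}"
  have "?X = W"
    by (rule max[OF _ _ nonseparable_Inter_halves[OF conn fin ns WV]]) (use WV in auto)
  then have "z \<notin> ?X" using z(2) by simp
  then obtain p D where D: "p \<in> V" "side E (V - {p}) D" "W \<subseteq> insert p D" "z \<notin> insert p D"
    using z(1) unfolding half_def by auto
  have "y \<notin> D"
  proof
    assume "y \<in> D"
    then have "{y, z} \<notin> E" using side_no_edge[OF D(2)] z(1) D(4) by auto
    then show False using z(3) by simp
  qed
  then have py: "p = y" using D(3) y by auto
  have "x \<in> D" using D(3) x py by auto
  moreover have "z \<in> V - {y}" using z y by auto
  ultimately have "\<not> connected_on E (V - {y})"
    using connected_onD[of E "V - {y}" D] D(2,4) py by blast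
  then show ?thesis using \<open>z \<in> V - {y}\<close> y WV unfolding separates_def by auto
qed

lemma connected_has_edge_at:
  assumes conn: "connected_on E V" and x: "x \<in> V" "V \<noteq> {x}"
  shows "\<exists>u\<in>V - {x}. {x, u} \<in> E"
proof (rule ccontr)
  assume "\<not> ?thesis"
  then have "side E V {x}" using x unfolding side_def by blast
  then show False using connected_onD[OF conn] x by blast
qed

lemma nonseparable_edge:
  assumes ab: "{a, b} \<in> E"
  shows "nonseparable E {a, b}"
  unfolding nonseparable_def
proof (intro conjI allI notI)
  show "connected_on E {a, b}"
  proof (rule connected_onI_avoiding)
    fix C assume C: "side E {a, b} C" "a \<notin> C"
    show "C = {}"
    proof (rule ccontr)
      assume "C \<noteq> {}"
      then have "b \<in> C" using C unfolding side_def by auto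
      then have "{b, a} \<notin> E" using side_no_edge[OF C(1), of b a] C(2) by auto
      then show False using ab by (simp add: insert_commute)
    qed
  qed simp
  fix x assume x: "separates E {a, b} x"
  then have "{a, b} - {x} = {a} \<or> {a, b} - {x} = {b}" unfolding separates_def by auto
  then show False using x connected_on_singleton unfolding separates_def by metis
qed

lemma block_set_extending:
  assumes "finite V" "nonseparable E W" "W \<subseteq> V"
  shows "\<exists>W'. block_set E V W' \<and> W \<subseteq> W'"
proof -
  let ?P = "\<lambda>X. W \<subseteq> X \<and> X \<subseteq> V \<and> nonseparable E X"
  \<comment> \<open>A maximal nonseparable set among those between \<open>W\<close> and \<open>V\<close>.\<close>
  have "finite {X. ?P X}" by (rule finite_subset[of _ "Pow V"]) (use assms(1) in auto)
  moreover have "W \<in> {X. ?P X}" using assms by auto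
  ultimately have "\<exists>X\<in>{X. ?P X}. W \<subseteq> X \<and> (\<forall>Y\<in>{X. ?P X}. X \<subseteq> Y \<longrightarrow> X = Y)"
    by (rule finite_has_maximal2)
  then obtain X where X0: "X \<in> {X. ?P X}" and max: "\<forall>Y\<in>{X. ?P X}. X \<subseteq> Y \<longrightarrow> X = Y"
    by (elim bexE conjE)
  have X: "?P X" using X0 by simp
  have "block_set E V X"
    unfolding block_set_def
  proof (intro conjI allI impI)
    fix Y assume Y: "X \<subseteq> Y \<and> Y \<subseteq> V \<and> nonseparable E Y"
    then have "Y \<in> {X. ?P X}" using X by auto
    then have "X = Y" using max Y by simp
    then show "Y = X" by simp
  qed (use X in auto)
  then show ?thesis using X by blast
qed

text \<open>
  Edges leave a block at cut-vertices only, and the only cut-vertex of this block is \<open>x\<close>.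
\<close>

lemma leaf_block_end_component:
  assumes conn: "connected_on E V" and fin: "finite V" and W: "block_set E V W"
    and x: "x \<in> W" "separates E V x" and uniq: "\<And>y. y \<in> W \<Longrightarrow> separates E V y \<Longrightarrow> y = x"
  shows "end_component E V x (W - {x})"
proof -
  have WV: "W \<subseteq> V" and ns: "nonseparable E W"
    and max: "\<And>W'. W \<subseteq> W' \<Longrightarrow> W' \<subseteq> V \<Longrightarrow> nonseparable E W' \<Longrightarrow> W' = W"
    using W unfolding block_set_def by auto
  have ne: "W - {x} \<noteq> {}"
  proof
    assume e: "W - {x} = {}"
    have "V \<noteq> {x}" using x(2) unfolding separates_def by auto
    then obtain u where u: "u \<in> V - {x}" "{x, u} \<in> E" using connected_has_edge_at[OF conn] x WV by blast
    have "{x, u} = W" by (rule max[OF _ _ nonseparable_edge[OF u(2)]]) (use e u x WV in auto)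
    then show False using u e by auto
  qed
  have c: "connected_on E (W - {x})" using ns x(1) ne unfolding nonseparable_def separates_def by blast
  have "side E (V - {x}) (W - {x})"
    unfolding side_def
  proof (intro conjI ballI notI)
    fix a b assume ab: "a \<in> W - {x}" "b \<in> V - {x} - (W - {x})" "{a, b} \<in> E"
    have "separates E V a"
      by (rule block_set_edge_leaving[OF conn fin W, of a b x]) (use ab x in auto)
    then show False using uniq ab by auto
  qed (use WV in auto)
  then show ?thesis using c ne x(2) uniq unfolding end_component_def by auto
qed

lemma end_component_determines_vertex:
  assumes conn: "connected_on E V" and C: "end_component E V x C" and D: "end_component E V y C"
  shows "x = y"
proof (rule ccontr)
  assume ne: "x \<noteq> y"
  have xV: "x \<in> V" and s: "side E (V - {x}) C" "C \<noteq> {}" and t: "side E (V - {y}) C"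
    and xC: "x \<notin> C"
    using C D unfolding end_component_def separates_def side_def by auto
  obtain u where u: "u \<in> C" "{u, x} \<in> E"
    using connected_edge_to_deleted[OF conn xV s] unfolding neighbours_def by auto
  show False using side_no_edge[OF t u(1), of x] u xC xV ne by auto
qed

text \<open>
  Removing its cut-vertex turns a leaf block into an end component; conversely an end component
  together with the vertex it is attached to is a block.
\<close>

lemma bij_betw_leaf_blocks_end_components:
  assumes conn: "connected_on E V" and fin: "finite V"
  shows "bij_betw (\<lambda>W. {y \<in> W. \<not> separates E V y})
     {W. block_set E V W \<and> (\<exists>!x. separates E V x \<and> x \<in> W)} {C. \<exists>x. end_component E V x C}"
proof -
  define f where "f = (\<lambda>W. {y \<in> W. \<not> separates E V y})"
  let ?L = "{W. block_set E V W \<and> (\<exists>!x. separates E V x \<and> x \<in> W)}"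
  have leaf: "\<exists>x. end_component E V x (f W) \<and> insert x (f W) = W" if W: "W \<in> ?L" for W
  proof -
    have ex: "\<exists>!x. separates E V x \<and> x \<in> W" using W by simp
    obtain x where x: "separates E V x" "x \<in> W" using ex1_implies_ex[OF ex] by blast
    have u: "y = x" if "y \<in> W" "separates E V y" for y using ex x that by blast
    have "f W = W - {x}" unfolding f_def using x u by blast
    then show ?thesis using leaf_block_end_component[OF conn fin _ x(2,1) u] W x by auto
  qed
  have "bij_betw f ?L {C. \<exists>x. end_component E V x C}"
    unfolding bij_betw_def
  proof (intro conjI)
    show "inj_on f ?L"
    proof (rule inj_onI)
      fix W W' assume W: "W \<in> ?L" "W' \<in> ?L" and eq: "f W = f W'"
      obtain x where x: "end_component E V x (f W)" "insert x (f W) = W" using leaf[OF W(1)] by blast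
      obtain x' where x': "end_component E V x' (f W)" "insert x' (f W) = W'"
        using leaf[OF W(2)] unfolding eq by blast
      show "W = W'" using end_component_determines_vertex[OF conn x(1) x'(1)] x(2) x'(2) by simp
    qed
    show "f ` ?L = {C. \<exists>x. end_component E V x C}"
    proof (intro set_eqI iffI)
      fix C assume "C \<in> f ` ?L"
      then obtain W where W: "C = f W" "W \<in> ?L" by (rule imageE)
      show "C \<in> {C. \<exists>x. end_component E V x C}" using leaf[OF W(2)] unfolding W(1) by blast
    next
      fix C assume "C \<in> {C. \<exists>x. end_component E V x C}"
      then obtain x where C: "end_component E V x C" by blast
      have sx: "separates E V x" and nC: "\<And>y. y \<in> C \<Longrightarrow> \<not> separates E V y"
        using C unfolding end_component_def by auto
      have uniq: "y = x" if "separates E V y \<and> y \<in> insert x C" for y using that nC by blast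
      have "insert x C \<in> ?L"
        using end_component_block_set[OF conn C] ex1I[of "\<lambda>y. separates E V y \<and> y \<in> insert x C", OF _ uniq] sx
        by simp
      moreover have "C = f (insert x C)" unfolding f_def using sx nC by blast
      ultimately show "C \<in> f ` ?L" by (rule rev_image_eqI)
    qed
  qed
  then show ?thesis unfolding f_def .
qed

section \<open>Smallest spread sets and the leaves of the block-cutpoint tree\<close>

lemma two_end_components:
  assumes conn: "connected_on E V" and fin: "finite V" and x: "separates E V x"
  shows "\<exists>y z C D. end_component E V y C \<and> end_component E V z D \<and> C \<inter> D = {}"
proof -
  obtain T where T: "side E (V - {x}) T" "T \<noteq> {}" "T \<noteq> V - {x}"
    using not_connected_onD[of E "V - {x}"] x unfolding separates_def by blast
  have "V - {x} - T \<noteq> {}" using T unfolding side_def by blast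
  then obtain z D where D: "end_component E V z D" "D \<subseteq> V - {x} - T"
    using end_component_exists[OF conn fin x side_Diff[OF T(1)]] by blast
  obtain y C where C: "end_component E V y C" "C \<subseteq> T"
    using end_component_exists[OF conn fin x T(1,2)] by blast
  have "C \<inter> D = {}" using C(2) D(2) by blast
  then show ?thesis using C(1) D(1) by blast
qed

lemma spread_meets_end_component:
  "spread E V U \<Longrightarrow> end_component E V x C \<Longrightarrow> C \<inter> U \<noteq> {}"
  unfolding spread_def end_component_def separates_def by blast

text \<open>
  Every side at a cut-vertex contains an end component. At any other vertex \<open>y\<close> the only
  side is \<open>V - {y}\<close>, and of two disjoint end components at least one avoids \<open>y\<close>.
\<close>

lemma spread_if_meets_end_components:
  assumes conn: "connected_on E V" and fin: "finite V" and x: "separates E V x"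
    and meets: "\<And>y C. end_component E V y C \<Longrightarrow> C \<inter> U \<noteq> {}"
  shows "spread E V U"
  unfolding spread_def
proof (intro ballI allI impI)
  fix y D assume y: "y \<in> V" and D: "side E (V - {y}) D \<and> D \<noteq> {}"
  show "D \<inter> U \<noteq> {}"
  proof (cases "separates E V y")
    case True
    then obtain z C where C: "end_component E V z C" "C \<subseteq> D"
      using end_component_exists[OF conn fin True] D by blast
    then show ?thesis using meets[OF C(1)] by blast
  next
    case False
    have "D \<subseteq> V - {y}" using D unfolding side_def by simp
    then have "connected_on E (V - {y})" using False y D unfolding separates_def by blast
    then have DV: "D = V - {y}" using connected_onD D by metis
    obtain a b A B where AB: "end_component E V a A" "end_component E V b B" "A \<inter> B = {}"
      using two_end_components[OF conn fin x] by blast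
    have "A \<subseteq> V" "B \<subseteq> V" using AB unfolding end_component_def side_def by blast+
    then have "A \<subseteq> D \<or> B \<subseteq> D" using AB(3) unfolding DV by blast
    then show ?thesis using meets[OF AB(1)] meets[OF AB(2)] by blast
  qed
qed

lemma finite_end_components: "finite V \<Longrightarrow> finite {C. \<exists>x. end_component E V x C}"
  by (rule finite_subset[of _ "Pow V"]) (auto simp: end_component_def side_def)

lemma card_end_components_ge_2:
  assumes conn: "connected_on E V" and fin: "finite V" and x: "separates E V x"
  shows "card {C. \<exists>x. end_component E V x C} \<ge> 2"
proof -
  obtain a b A B where AB: "end_component E V a A" "end_component E V b B" "A \<inter> B = {}"
    using two_end_components[OF conn fin x] by blast
  have "A \<noteq> {}" using AB(1) unfolding end_component_def by simp
  then have "A \<noteq> B" using AB(3) by blast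
  then have "card {A, B} = 2" by simp
  moreover have "card {A, B} \<le> card {C. \<exists>x. end_component E V x C}"
    by (rule card_mono[OF finite_end_components[OF fin]]) (use AB in blast)
  ultimately show ?thesis by simp
qed

lemma inj_on_end_component_choice:
  assumes f: "\<And>C x. end_component E V x C \<Longrightarrow> f C \<in> C"
  shows "inj_on f {C. \<exists>x. end_component E V x C}"
proof (rule inj_onI)
  fix C D assume "C \<in> {C. \<exists>x. end_component E V x C}" "D \<in> {C. \<exists>x. end_component E V x C}"
    and eq: "f C = f D"
  then obtain x y where C: "end_component E V x C" and D: "end_component E V y D" by blast
  have "C \<inter> D \<noteq> {}" using f[OF C] f[OF D] eq by auto
  then show "C = D" using end_components_eq[OF C D] by blast
qed

lemma card_end_components_le_spread:
  assumes spr: "spread E V U" and fin: "finite U"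
  shows "card {C. \<exists>x. end_component E V x C} \<le> card U"
proof -
  define f where "f C = (SOME u. u \<in> C \<inter> U)" for C
  have f: "f C \<in> C \<inter> U" if "end_component E V x C" for x C
    unfolding f_def by (rule someI_ex) (use spread_meets_end_component[OF spr that] in blast)
  show ?thesis
  proof (rule card_inj_on_le[OF _ _ fin])
    show "inj_on f {C. \<exists>x. end_component E V x C}"
      by (rule inj_on_end_component_choice) (use f in blast)
    show "f ` {C. \<exists>x. end_component E V x C} \<subseteq> U" using f by blast
  qed
qed

lemma spread_of_card_end_components:
  assumes conn: "connected_on E V" and fin: "finite V" and x: "separates E V x"
  shows "\<exists>U\<subseteq>V. spread E V U \<and> card U = card {C. \<exists>x. end_component E V x C}"
proof -
  let ?C = "{C. \<exists>x. end_component E V x C}"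
  define f where "f C = (SOME u. u \<in> C)" for C :: "'a set"
  have f: "f C \<in> C" if "end_component E V x C" for x C
    unfolding f_def by (rule someI_ex) (use that in \<open>auto simp: end_component_def\<close>)
  have "f ` ?C \<subseteq> V" using f unfolding end_component_def side_def by blast
  moreover have "spread E V (f ` ?C)"
    by (rule spread_if_meets_end_components[OF conn fin x]) (use f in blast)
  moreover have "card (f ` ?C) = card ?C"
    by (rule card_image[OF inj_on_end_component_choice]) (rule f)
  ultimately show ?thesis by blast
qed

text \<open>
  Take edges from \<open>x\<close> into two different components of \<open>V - {x}\<close>: no block contains both, since
  a block stays connected when \<open>x\<close> is removed.
\<close>

lemma two_block_sets_at_separator:
  assumes conn: "connected_on E V" and fin: "finite V" and x: "separates E V x"
  shows "\<exists>W W'. block_set E V W \<and> block_set E V W' \<and> x \<in> W \<and> x \<in> W' \<and> W \<noteq> W'"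
proof -
  have xV: "x \<in> V" using x unfolding separates_def by simp
  obtain T where T: "side E (V - {x}) T" "T \<noteq> {}" "T \<noteq> V - {x}"
    using not_connected_onD[of E "V - {x}"] x unfolding separates_def by blast
  have T': "V - {x} - T \<noteq> {}" using T unfolding side_def by blast
  obtain u where u: "u \<in> T" "u \<in> V" "{u, x} \<in> E"
    using connected_edge_to_deleted[OF conn xV T(1,2)] unfolding neighbours_def by blast
  obtain v where v: "v \<in> V - {x} - T" "{v, x} \<in> E"
    using connected_edge_to_deleted[OF conn xV side_Diff[OF T(1)] T'] unfolding neighbours_def by blast
  obtain W where W: "block_set E V W" "{u, x} \<subseteq> W"
    using block_set_extending[OF fin nonseparable_edge[OF u(3)]] u(2) xV by auto
  obtain W' where W': "block_set E V W'" "{v, x} \<subseteq> W'"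
    using block_set_extending[OF fin nonseparable_edge[OF v(2)]] v(1) xV by auto
  have uT: "u \<in> W - {x}" using u(1) W(2) T(1) unfolding side_def by blast
  have "W \<noteq> W'"
  proof
    assume eq: "W = W'"
    have "nonseparable E W" and WV: "W \<subseteq> V" using W(1) unfolding block_set_def by auto
    then have c: "connected_on E (W - {x})"
      using uT W(2) unfolding nonseparable_def separates_def by blast
    have "W - {x} \<subseteq> T" by (rule connected_side_subset[OF c _ T(1)]) (use WV uT u(1) in auto)
    then show False using v(1) W'(2) eq by blast
  qed
  then show ?thesis using W W' by blast
qed

text \<open>Every cut-vertex lies on at least two blocks, so only blocks can be leaves.\<close>

lemma graph_leaves_block_cutpoint_tree:
  assumes G: "simple_graph G" and conn: "connected_graph G"
  shows "graph_leaves (block_cutpoint_tree G) = Inl ` {B \<in> blocks G. \<exists>!x. cut_vertex G x \<and> x \<in> gverts B}"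
proof -
  let ?T = "block_cutpoint_tree G"
  have deg_Inl: "card {e \<in> gedges ?T. Inl B \<in> e} = card {x. cut_vertex G x \<and> x \<in> gverts B}"
    if B: "B \<in> blocks G" for B
  proof -
    have "{e \<in> gedges ?T. Inl B \<in> e} = (\<lambda>x. {Inl B, Inr x}) ` {x. cut_vertex G x \<and> x \<in> gverts B}"
      (is "?S = ?I")
    proof (intro set_eqI iffI)
      fix e assume "e \<in> ?S"
      then obtain B' x where e: "e = {Inl B', Inr x}" "cut_vertex G x" "x \<in> gverts B'" "Inl B \<in> e"
        unfolding block_cutpoint_tree_def snd_conv by blast
      then have "B' = B" by simp
      then show "e \<in> ?I" using e by simp
    next
      fix e assume "e \<in> ?I"
      then obtain x where x: "e = {Inl B, Inr x}" "cut_vertex G x" "x \<in> gverts B" by blast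
      then have "e \<in> gedges ?T" using B unfolding block_cutpoint_tree_def snd_conv by blast
      then show "e \<in> ?S" using x(1) by simp
    qed
    moreover have "inj_on (\<lambda>x. {Inl B, Inr x}) {x. cut_vertex G x \<and> x \<in> gverts B}"
      by (rule inj_onI) (auto simp: doubleton_eq_iff)
    ultimately show ?thesis by (simp add: card_image)
  qed
  have deg_Inr: "card {e \<in> gedges ?T. Inr x \<in> e} \<noteq> 1" if x: "cut_vertex G x" for x
  proof
    assume "card {e \<in> gedges ?T. Inr x \<in> e} = 1"
    then obtain e where e: "{e \<in> gedges ?T. Inr x \<in> e} = {e}" by (auto simp: card_1_singleton_iff)
    have "separates (gedges G) (gverts G) x" using x cut_vertex_iff[OF G conn] by simp
    then obtain W W' where W: "block_set (gedges G) (gverts G) W" "block_set (gedges G) (gverts G) W'"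
      "x \<in> W" "x \<in> W'" "W \<noteq> W'"
      using two_block_sets_at_separator connected_graph_iff[OF G] conn G unfolding simple_graph_def by metis
    let ?B = "(W, edges_in (gedges G) W)" and ?B' = "(W', edges_in (gedges G) W')"
    have "?B \<in> blocks G" "?B' \<in> blocks G" using W unfolding blocks_eq[OF G] by auto
    then have "{Inl ?B, Inr x} \<in> {e \<in> gedges ?T. Inr x \<in> e}" "{Inl ?B', Inr x} \<in> {e \<in> gedges ?T. Inr x \<in> e}"
      using x W unfolding block_cutpoint_tree_def by auto
    then have "{Inl ?B, Inr x} = {Inl ?B', Inr x}" unfolding e by simp
    then show False using W(5) by (auto simp: doubleton_eq_iff)
  qed
  have uniq: "card {x. cut_vertex G x \<and> x \<in> gverts B} = 1 \<longleftrightarrow> (\<exists>!x. cut_vertex G x \<and> x \<in> gverts B)" for B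
  proof -
    have "(\<exists>a. {x. P x} = {a}) \<longleftrightarrow> (\<exists>!x. P x)" for P :: "'a \<Rightarrow> bool"
      unfolding Ex1_def set_eq_iff by auto
    then show ?thesis unfolding One_nat_def card_1_singleton_iff .
  qed
  have V: "gverts ?T = Inl ` blocks G \<union> Inr ` {x. cut_vertex G x}"
    unfolding block_cutpoint_tree_def by simp
  show ?thesis
  proof (intro set_eqI iffI)
    fix v assume v: "v \<in> graph_leaves ?T"
    then have d: "card {e \<in> gedges ?T. v \<in> e} = 1" and "v \<in> Inl ` blocks G \<union> Inr ` {x. cut_vertex G x}"
      unfolding graph_leaves_def V by simp_all
    then consider B where "v = Inl B" "B \<in> blocks G" | x where "v = Inr x" "cut_vertex G x" by blast
    then show "v \<in> Inl ` {B \<in> blocks G. \<exists>!x. cut_vertex G x \<and> x \<in> gverts B}"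
    proof cases
      case (1 B)
      then have "\<exists>!x. cut_vertex G x \<and> x \<in> gverts B" using d deg_Inl[of B] uniq[of B] by simp
      then show ?thesis using 1 by simp
    next
      case (2 x)
      then show ?thesis using d deg_Inr[of x] by simp
    qed
  next
    fix v :: "'a ugraph + 'a" assume "v \<in> Inl ` {B \<in> blocks G. \<exists>!x. cut_vertex G x \<and> x \<in> gverts B}"
    then obtain B where B: "v = Inl B" "B \<in> blocks G" "\<exists>!x. cut_vertex G x \<and> x \<in> gverts B" by blast
    then have "card {e \<in> gedges ?T. v \<in> e} = 1" using deg_Inl[of B] uniq[of B] by simp
    then show "v \<in> graph_leaves ?T" using B unfolding graph_leaves_def V by simp
  qed
qed

lemma card_leaf_blocks:
  assumes G: "simple_graph G" and conn: "connected_graph G"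
  shows "card {B \<in> blocks G. \<exists>!x. cut_vertex G x \<and> x \<in> gverts B} =
    card {C. \<exists>x. end_component (gedges G) (gverts G) x C}"
proof -
  let ?E = "gedges G" and ?V = "gverts G"
  let ?L = "{W. block_set ?E ?V W \<and> (\<exists>!x. separates ?E ?V x \<and> x \<in> W)}"
  have c: "connected_on ?E ?V" and fin: "finite ?V"
    using conn connected_graph_iff[OF G] G unfolding simple_graph_def by simp_all
  have "{B \<in> blocks G. \<exists>!x. cut_vertex G x \<and> x \<in> gverts B} = (\<lambda>W. (W, edges_in ?E W)) ` ?L"
    (is "_ = ?f ` ?L")
  proof -
    have filter_image: "{B \<in> f ` S. P B} = f ` {W \<in> S. P (f W)}"
      for f :: "'a set \<Rightarrow> 'a ugraph" and S P by blast
    have "{B \<in> blocks G. \<exists>!x. cut_vertex G x \<and> x \<in> gverts B}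
        = ?f ` {W \<in> {W. block_set ?E ?V W}. \<exists>!x. cut_vertex G x \<and> x \<in> gverts (?f W)}"
      unfolding blocks_eq[OF G] by (rule filter_image)
    then show ?thesis by (simp add: cut_vertex_iff[OF G conn])
  qed
  moreover have "inj_on (\<lambda>W. (W, edges_in ?E W)) ?L" by (rule inj_onI) simp
  ultimately show ?thesis
    using bij_betw_same_card[OF bij_betw_leaf_blocks_end_components[OF c fin]] by (simp add: card_image)
qed

section \<open>Vanishing and sign of the Elser numbers\<close>

lemma els_0_eq: "simple_graph G \<Longrightarrow> els 0 G = nucleus_sum (gedges G) {} (gverts G)"
proof -
  assume G: "simple_graph G"
  have "{xs. set xs \<subseteq> gverts G \<and> length xs = 0} = {[]}" by auto
  then show ?thesis using els_eq_sum_lists[OF G, of 0] by simp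
qed

text \<open>
  All summands of \<open>els_eq_sum_lists\<close> are nonnegative, so one positive summand decides. A spread set with
  fewer than \<open>k\<close> elements is listed with repetitions.
\<close>

lemma els_pos_iff:
  assumes G: "simple_graph G" and conn: "connected_graph G" and k: "k > 0"
  shows "els k G \<ge> 0"
    and "els k G \<noteq> 0 \<longleftrightarrow> (\<exists>U. U \<noteq> {} \<and> U \<subseteq> gverts G \<and> card U \<le> k \<and> spread (gedges G) (gverts G) U)"
proof -
  let ?E = "gedges G" and ?V = "gverts G"
  let ?L = "{xs. set xs \<subseteq> ?V \<and> length xs = k}"
  have c: "connected_on ?E ?V" and fin: "finite ?V" and two: "\<forall>e\<in>?E. card e = 2"
    using conn connected_graph_iff[OF G] G unfolding simple_graph_def by simp_all
  have fL: "finite ?L" using finite_lists_length_eq[OF fin] .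
  have ne: "set xs \<noteq> {}" "set xs \<subseteq> ?V" if "xs \<in> ?L" for xs using that k by auto
  have nonneg: "nucleus_sum ?E (set xs) ?V \<ge> 0" if "xs \<in> ?L" for xs
    using nucleus_sum_nonneg[OF fin two c] ne[OF that] by blast
  show "els k G \<ge> 0" unfolding els_eq_sum_lists[OF G] by (rule sum_nonneg) (rule nonneg)
  have zero: "nucleus_sum ?E (set xs) ?V \<noteq> 0 \<longleftrightarrow> spread ?E ?V (set xs)" if "xs \<in> ?L" for xs
    using nucleus_sum_pos_iff_spread[OF fin two c ne[OF that]] nonneg[OF that] by linarith
  have "els k G \<noteq> 0 \<longleftrightarrow> (\<exists>xs\<in>?L. nucleus_sum ?E (set xs) ?V \<noteq> 0)"
    unfolding els_eq_sum_lists[OF G] using sum_nonneg_eq_0_iff[OF fL nonneg] by simp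
  also have "\<dots> \<longleftrightarrow> (\<exists>xs\<in>?L. spread ?E ?V (set xs))" using zero by blast
  also have "\<dots> \<longleftrightarrow> (\<exists>U. U \<noteq> {} \<and> U \<subseteq> ?V \<and> card U \<le> k \<and> spread ?E ?V U)"
  proof
    assume "\<exists>xs\<in>?L. spread ?E ?V (set xs)"
    then obtain xs where xs: "xs \<in> ?L" "spread ?E ?V (set xs)" by blast
    moreover have "card (set xs) \<le> k" using card_length[of xs] xs(1) by simp
    ultimately show "\<exists>U. U \<noteq> {} \<and> U \<subseteq> ?V \<and> card U \<le> k \<and> spread ?E ?V U" using ne by blast
  next
    assume "\<exists>U. U \<noteq> {} \<and> U \<subseteq> ?V \<and> card U \<le> k \<and> spread ?E ?V U"
    then obtain U where U: "U \<noteq> {}" "U \<subseteq> ?V" "card U \<le> k" "spread ?E ?V U" by blast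
    \<comment> \<open>Pad a list of the elements of \<open>U\<close> with copies of one of them to reach length \<open>k\<close>.\<close>
    obtain us where us: "set us = U" "distinct us"
      using finite_distinct_list finite_subset[OF U(2) fin] by blast
    obtain u where u: "u \<in> U" using U(1) by blast
    have len: "length us = card U" using distinct_card[OF us(2)] us(1) by simp
    define xs where "xs = us @ replicate (k - card U) u"
    have "set xs = U" using us u unfolding xs_def by auto
    moreover have "length xs = k" using len U(3) unfolding xs_def by simp
    ultimately have "xs \<in> ?L" "spread ?E ?V (set xs)" using U by simp_all
    then show "\<exists>xs\<in>?L. spread ?E ?V (set xs)" by blast
  qed
  finally show "els k G \<noteq> 0 \<longleftrightarrow> (\<exists>U. U \<noteq> {} \<and> U \<subseteq> ?V \<and> card U \<le> k \<and> spread ?E ?V U)" .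
qed

lemma spread_card_ge_2:
  assumes "spread E V U" "U \<noteq> {}" "U \<subseteq> V" "finite V" "card V \<ge> 2"
  shows "card U \<ge> 2"
proof -
  obtain u where u: "u \<in> U" using assms(2) by blast
  have "side E (V - {u}) (V - {u})" unfolding side_def by simp
  moreover have "V - {u} \<noteq> {}"
  proof
    assume "V - {u} = {}"
    then have "card V \<le> card {u}" by (intro card_mono) auto
    then show False using assms(5) by simp
  qed
  ultimately obtain v where v: "v \<in> U" "v \<noteq> u" using assms(1,3) u unfolding spread_def by blast
  then have "card {u, v} = 2" by simp
  moreover have "card {u, v} \<le> card U"
    by (rule card_mono) (use u v finite_subset[OF assms(3,4)] in auto)
  ultimately show ?thesis by simp
qed

theorem theorem1p2:
  fixes G :: "'a ugraph"
  assumes "simple_graph G" and "connected_graph G" and "card (gverts G) \<ge> 2"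
  shows "((\<nexists>x. cut_vertex G x) \<longrightarrow>
            els 0 G < 0 \<and> els 1 G = 0 \<and> (\<forall>k\<ge>2. els k G > 0)) \<and>
         ((\<exists>x. cut_vertex G x) \<longrightarrow>
            (let l = card (graph_leaves (block_cutpoint_tree G)) in
               l = card {B \<in> blocks G. \<exists>!x. cut_vertex G x \<and> x \<in> gverts B} \<and>
               l \<ge> 2 \<and>
               (\<forall>k. els k G \<noteq> 0 \<longleftrightarrow> k \<ge> l)))"
proof (intro conjI impI)
  let ?E = "gedges G" and ?V = "gverts G"
  note G = assms(1) and conn = assms(2)
  note cut = cut_vertex_iff[OF G conn]
  have c: "connected_on ?E ?V" and fin: "finite ?V" and two: "\<forall>e\<in>?E. card e = 2"
    using conn connected_graph_iff[OF G] G unfolding simple_graph_def by simp_all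
  obtain S where "S \<subseteq> ?V" "card S = 2" using obtain_subset_with_card_n[OF assms(3)] by blast
  then obtain p q where pq: "p \<in> ?V" "q \<in> ?V" "p \<noteq> q" unfolding card_2_iff by blast
  {
    assume "\<nexists>x. cut_vertex G x"
    then have ns: "\<not> separates ?E ?V w" for w using cut by blast
    show "els 0 G < 0"
      unfolding els_0_eq[OF G]
      by (rule nucleus_sum_empty_neg[OF fin two c ns pq(1)]) (use pq in auto)
    show "els 1 G = 0"
      using els_pos_iff(2)[OF G conn, of 1] spread_card_ge_2[OF _ _ _ fin assms(3)] by fastforce
    show "\<forall>k\<ge>2. els k G > 0"
    proof (intro allI impI)
      fix k :: nat assume k: "k \<ge> 2"
      have "spread ?E ?V {p, q}"
        by (rule spread_nonseparable[OF ns, of p _ q]) (use pq in auto)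
      moreover have "card {p, q} \<le> k" using pq(3) k by simp
      moreover have k0: "k > 0" using k by simp
      ultimately have "els k G \<noteq> 0"
        unfolding els_pos_iff(2)[OF G conn k0] by (intro exI[of _ "{p, q}"]) (use pq in simp)
      then show "els k G > 0" using els_pos_iff(1)[OF G conn, of k] k by linarith
    qed
  next
    let ?l = "card {C. \<exists>x. end_component ?E ?V x C}"
    assume "\<exists>x. cut_vertex G x"
    then obtain x where x: "separates ?E ?V x" using cut by blast
    have leaves: "card (graph_leaves (block_cutpoint_tree G)) =
        card {B \<in> blocks G. \<exists>!x. cut_vertex G x \<and> x \<in> gverts B}"
      unfolding graph_leaves_block_cutpoint_tree[OF G conn] by (rule card_image) simp
    have l2: "?l \<ge> 2" using card_end_components_ge_2[OF c fin x] .
    have "els k G \<noteq> 0 \<longleftrightarrow> k \<ge> ?l" for k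
    proof (cases "k = 0")
      case True
      then show ?thesis using els_0_eq[OF G] nucleus_sum_empty_eq_0[OF fin two c x] l2 by simp
    next
      case False
      show ?thesis
      proof
        assume "els k G \<noteq> 0"
        then obtain U where U: "U \<subseteq> ?V" "card U \<le> k" "spread ?E ?V U"
          using els_pos_iff(2)[OF G conn] False by blast
        then show "k \<ge> ?l"
          using card_end_components_le_spread[OF U(3) finite_subset[OF U(1) fin]] by linarith
      next
        assume k: "k \<ge> ?l"
        obtain U where U: "U \<subseteq> ?V" "spread ?E ?V U" "card U = ?l"
          using spread_of_card_end_components[OF c fin x] by blast
        then have "U \<noteq> {}" using l2 by auto
        then show "els k G \<noteq> 0" using els_pos_iff(2)[OF G conn, of k] False U k by auto
      qed
    qed
    then show "let l = card (graph_leaves (block_cutpoint_tree G)) in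
        l = card {B \<in> blocks G. \<exists>!x. cut_vertex G x \<and> x \<in> gverts B} \<and> l \<ge> 2 \<and>
        (\<forall>k. els k G \<noteq> 0 \<longleftrightarrow> k \<ge> l)"
      unfolding Let_def leaves card_leaf_blocks[OF G conn] using l2 by simp
  }
qed

end
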